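(* Let $k\ge 4$ be an even integer. The zeros of ${\rm E}_k'$ in ${\rm D}$ are simple, and each of them has real part either $\frac12$ or $-\frac12$. Moreover, the zeros with real part $\frac12$ are exactly the translates by $1$ of the zeros with real part $-\frac12$.
   Context: $\mathfrak{H}$ denotes the Poincaré upper half-plane. For an even integer $k\ge4$, ${\rm E}_k$ is the normalized Eisenstein series of weight $k$ for ${\bf SL}_2({\bf Z})$: ${\rm E}_k(z)=1-\frac{2k}{{\rm B}_k}\sum_{n\ge1}\sigma_{k-1}(n)q^n$, with $q=e^{2\pi i z}$, ${\rm B}_k$ the $k$-th Bernoulli number and $\sigma_{k-1}(n)$ the sum of the $(k-1)$-th powers of the positive divisors of $n$. ${\rm E}_k'$ denotes its derivative with respect to $z$. ${\rm D}=\{z\in\mathfrak{H} : |\Re(z)|\le\frac12,\ |z|\ge1\}$ is the closure of the standard fundamental domain. *)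

theory Defs
  imports
    "HOL-Complex_Analysis.Complex_Analysis"
    "HOL-Computational_Algebra.Computational_Algebra"
begin

text \<open>
  The Bernoulli numbers are given by their exponential generating function
  \<open>x / (e\<^sup>x - 1) = (\<Sum>n. B\<^sub>n x\<^sup>n / n!)\<close>. The quotient is one of formal power series;
  it is exact because the denominator has order 1.
\<close>

definition bernoulli :: "nat \<Rightarrow> real" where
  "bernoulli n = fact n * fps_nth (fps_X / (fps_exp 1 - 1)) n"

lemma bernoulli_generating_function:
  "Abs_fps (\<lambda>n. bernoulli n / fact n) * (fps_exp 1 - 1) = fps_X"
proof -
  have sub: "subdegree (fps_exp (1::real) - 1) = 1"
    by (rule subdegreeI) auto
  hence nz: "fps_exp (1::real) - 1 \<noteq> 0"
    by auto
  have "(fps_exp (1::real) - 1) dvd fps_X"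
    by (subst fps_dvd_iff) (use nz sub in auto)
  moreover have "Abs_fps (\<lambda>n. bernoulli n / fact n) = fps_X / (fps_exp (1::real) - 1)"
    by (auto simp: fps_eq_iff bernoulli_def)
  ultimately show ?thesis
    by simp
qed

definition divisor_sigma :: "nat \<Rightarrow> nat \<Rightarrow> nat" where
  "divisor_sigma s n = (\<Sum>d | d dvd n. d ^ s)"

definition upper_half_plane :: "complex set" where
  "upper_half_plane = {z. Im z > 0}"

text \<open>
  Only the values on the upper half-plane are meaningful, where the series converges absolutely.
  The summation index is shifted by one.
\<close>

definition eisenstein_E :: "nat \<Rightarrow> complex \<Rightarrow> complex" where
  "eisenstein_E k z =
     1 - of_real (2 * real k / bernoulli k) *
       (\<Sum>n. of_nat (divisor_sigma (k - 1) (Suc n)) * exp (2 * of_real pi * \<i> * z) ^ Suc n)"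

definition fundamental_region :: "complex set" where
  "fundamental_region = {z \<in> upper_half_plane. \<bar>Re z\<bar> \<le> 1 / 2 \<and> norm z \<ge> 1}"

end

theory Submission
  imports Defs
begin

text \<open>
  Up to a nonzero constant, \<open>E\<^sub>k'(z)\<close> is the power series \<open>P(q) = \<Sum>n. n \<sigma>\<^bsub>k-1\<^esub>(n) q\<^sup>n\<close>, and the
  Lipschitz formula turns it into the lattice sum \<open>\<Phi>(z) = \<Sum>c\<ge>1. c \<Sum>b. (c z + b)\<^sup>-\<^sup>s\<close> with \<open>s = k + 1\<close>.
  On \<open>\<bar>Re z\<bar> \<le> 1/2\<close> the two terms \<open>z\<^sup>-\<^sup>s\<close> and \<open>(z \<plusminus> 1)\<^sup>-\<^sup>s\<close> dominate. At the heights
  \<open>y\<^sub>j = 1 / (2 tan (j \<pi> / s))\<close> they have equal phase on the line \<open>Re z = -1/2\<close>. With \<open>J\<close> the least \<open>j\<close> such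
  that \<open>y\<^sub>j \<le> \<surd>3/2\<close>, the product \<open>z\<^sup>s \<Phi>(z)\<close> has positive real part on the whole segment at height \<open>y\<^sub>J\<close>,
  so the argument principle gives exactly \<open>J\<close> zeros of \<open>P\<close>, with multiplicity, in the disc
  \<open>\<bar>q\<bar> < exp (-2 \<pi> y\<^sub>J)\<close>, whose closure contains the image of the
  fundamental domain. On the other hand \<open>P\<close> vanishes at \<open>0\<close> and changes sign between \<open>J\<close> consecutive points of the negative
  real axis: the points of height \<open>y\<^sub>j\<close> if \<open>k < 4 j\<^sup>2\<close> or \<open>j = J\<close>, and those of height \<open>k / (2 \<pi> j)\<close>
  otherwise, where the \<open>j\<close>-th term of the power series dominates. Hence all these zeros are simple
  and the nonzero ones lie on the negative axis, that is on \<open>Re z = \<plusminus>1/2\<close>. The estimates need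
  \<open>k \<ge> 8\<close>; for \<open>k = 4\<close> and \<open>k = 6\<close> the first term of \<open>P\<close> dominates and there are no zeros at all.
\<close>

section \<open>Bernoulli numbers of even index\<close>

text \<open>
  The even function \<open>g = x / (e\<^sup>x - 1) + x / 2\<close> satisfies \<open>x g' = g - g\<^sup>2 + x\<^sup>2 / 4\<close>, a quadratic
  recurrence for its coefficients from which their signs can be read off.
\<close>

lemma bernoulli_even_sign:
  assumes "n > 0"
  shows "(-1) ^ Suc n * bernoulli (2 * n) > 0"
proof -
  define B where "B = Abs_fps (\<lambda>n. bernoulli n / fact n)"
  define E where "E = (fps_exp 1 :: real fps)"
  define h where "h = (fps_const (1 / 2) * fps_X :: real fps)"
  define g where "g = B + h"
  have BE: "B * E = fps_X + B"
    using bernoulli_generating_function unfolding B_def E_def by (simp add: algebra_simps)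
  \<comment> \<open>Since \<open>E\<close> is its own derivative, differentiating \<open>BE\<close>
    and multiplying by \<open>B\<close> leaves \<open>E\<close> only inside products
    \<open>B * E\<close>, which \<open>BE\<close> eliminates; what remains is a Riccati equation for
    \<open>B\<close>.\<close>
  have "fps_deriv (B * E) = 1 + fps_deriv B"
    unfolding BE by simp
  moreover have "fps_deriv (B * E) = fps_deriv B * E + B * E"
    unfolding E_def by (simp add: algebra_simps)
  ultimately have "B * (fps_deriv B * E + B * E) = B * (1 + fps_deriv B)"
    by simp
  hence "fps_deriv B * (B * E) + B * (B * E) = B + B * fps_deriv B"
    by (simp add: algebra_simps)
  hence XB: "fps_X * fps_deriv B = B - fps_X * B - B * B"
    unfolding BE by (simp add: algebra_simps)
  have h2: "h + h = fps_X"
  proof -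
    have "fps_const (1 / 2) + fps_const (1 / 2) = (1 :: real fps)"
      by (simp add: fps_const_add)
    thus ?thesis
      unfolding h_def by (metis distrib_right mult_1)
  qed
  have "fps_X * fps_deriv h = h"
    unfolding h_def by (simp add: fps_deriv_mult algebra_simps)
  hence "fps_X * fps_deriv g = B - (h + h) * B - B * B + h"
    unfolding g_def using XB h2 by (simp add: algebra_simps)
  also have "\<dots> = g - g * g + h * h"
    unfolding g_def by (simp add: algebra_simps)
  finally have ode: "fps_X * fps_deriv g = g - g * g + h * h" .
  have "fps_nth (B * (fps_exp 1 - 1)) 1 = fps_nth fps_X 1"
    using bernoulli_generating_function unfolding B_def by simp
  hence g0: "fps_nth g 0 = 1"
    by (simp add: fps_mult_nth g_def h_def)
  have hh: "fps_nth (h * h) n = (if n = 2 then 1 / 4 else 0)" for n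
  proof -
    have "h * h = fps_const (1 / 4) * fps_X ^ 2"
      unfolding h_def by (simp add: power2_eq_square mult_ac fps_const_mult flip: mult.assoc)
    thus ?thesis by simp
  qed
  \<comment> \<open>The two end terms of the convolution contribute \<open>2 g_n\<close> because
    \<open>g_0 = 1\<close>; this turns the factor \<open>n - 1\<close> on the left into
    \<open>n + 1\<close>.\<close>
  have rec: "real (Suc n) * fps_nth g n =
      (if n = 2 then 1 / 4 else 0) - (\<Sum>i\<in>{1..<n}. fps_nth g i * fps_nth g (n - i))"
    if "n > 0" for n
  proof -
    have "fps_nth (fps_X * fps_deriv g) n = real n * fps_nth g n"
      using that by (cases n) (auto simp: algebra_simps)
    moreover have "fps_nth (g * g) n = (\<Sum>i=0..n. fps_nth g i * fps_nth g (n - i))"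
      by (simp add: fps_mult_nth)
    moreover have "{0..n} = insert 0 (insert n {1..<n})"
      using that by auto
    ultimately show ?thesis
      using arg_cong[OF ode, of "\<lambda>f. fps_nth f n"] hh[of n] that g0
      by (simp add: algebra_simps)
  qed
  have odd0: "fps_nth g n = 0" if "odd n" for n
    using that
  proof (induction n rule: less_induct)
    case (less n)
    have "(\<Sum>i\<in>{1..<n}. fps_nth g i * fps_nth g (n - i)) = 0"
    proof (intro sum.neutral ballI)
      fix i assume i: "i \<in> {1..<n}"
      show "fps_nth g i * fps_nth g (n - i) = 0"
        using less.IH[of i] less.IH[of "n - i"] less.prems i by (cases "odd i") auto
    qed
    moreover have "n > 0" "n \<noteq> 2"
      using less.prems by (auto intro: Nat.gr0I)
    ultimately show ?case
      using rec[of n] by simp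
  qed
  \<comment> \<open>By induction all products \<open>g_{2i} g_{2m-2i}\<close> have sign
    \<open>(-1)^m\<close>, so nothing cancels and the minus sign in \<open>rec\<close> yields the
    next sign. The term \<open>1 / 4\<close> enters only for \<open>m = 1\<close>.\<close>
  have even: "(-1) ^ Suc m * fps_nth g (2 * m) > 0" if "m > 0" for m
    using that
  proof (induction m rule: less_induct)
    case (less m)
    show ?case
    proof (cases "m = 1")
      case True
      have "fps_nth g (Suc 0) = 0"
        using odd0[of 1] by simp
      hence "real (Suc 2) * fps_nth g 2 = 1 / 4"
        using rec[of 2] by (simp add: sum.atLeast_Suc_lessThan numeral_2_eq_2)
      thus ?thesis using True by simp
    next
      case False
      let ?t = "\<lambda>i. fps_nth g i * fps_nth g (2 * m - i)"
      have ev: "(-1) ^ m * ?t (2 * i) > 0" if "0 < i" "i < m" for i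
      proof -
        have "0 < ((-1) ^ Suc i * fps_nth g (2 * i)) * ((-1) ^ Suc (m - i) * fps_nth g (2 * (m - i)))"
          using less.IH[of i] less.IH[of "m - i"] that by (intro mult_pos_pos less.IH) linarith+
        also have "\<dots> = (-1) ^ (Suc i + Suc (m - i)) * ?t (2 * i)"
          by (simp add: power_add right_diff_distrib')
        also have "Suc i + Suc (m - i) = m + 2"
          using that by simp
        finally show ?thesis by simp
      qed
      have nn: "(-1) ^ m * ?t i \<ge> 0" if "i \<in> {1..<2*m}" for i
      proof (cases "odd i")
        case True
        thus ?thesis using odd0[of i] by simp
      next
        case False
        then obtain l where l: "i = 2 * l" by blast
        have "0 < l" "l < m" using that unfolding l by auto
        thus ?thesis using ev[of l] unfolding l by simp
      qed
      have "0 < (\<Sum>i\<in>{1..<2*m}. (-1) ^ m * ?t i)"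
        using nn ev[of 1] False less.prems by (intro sum_pos2[of _ 2]) auto
      also have "\<dots> = (-1) ^ m * (- (real (Suc (2 * m)) * fps_nth g (2 * m)))"
        using rec[of "2 * m"] less.prems False by (simp add: sum_distrib_left)
      also have "\<dots> = real (Suc (2 * m)) * ((-1) ^ Suc m * fps_nth g (2 * m))"
        by simp
      finally show ?thesis
        by (simp only: zero_less_mult_iff) auto
    qed
  qed
  have "fps_nth g (2 * n) = bernoulli (2 * n) / fact (2 * n)"
    using assms by (simp add: g_def B_def h_def)
  with even[OF assms] show ?thesis
    by (simp add: divide_less_0_iff)
qed

section \<open>The power series of the derivative\<close>

text \<open>The polylogarithm of order \<open>-k\<close>, summed from \<open>n = 0\<close>: for
  \<open>k = 0\<close> this includes the term \<open>0 ^ 0 = 1\<close>, so the value is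
  \<open>1 / (1 - q)\<close>.\<close>

definition polylog_neg :: "nat \<Rightarrow> complex \<Rightarrow> complex" where
  "polylog_neg k q = (\<Sum>n. of_nat n ^ k * q ^ n)"

lemma summable_power_times_geometric:
  fixes q :: "'a :: {real_normed_field, banach}"
  assumes "norm q < 1"
  shows "summable (\<lambda>n. of_nat n ^ k * q ^ n)"
  using assms
proof (induction k arbitrary: q)
  case 0
  thus ?case by (simp add: summable_geometric)
next
  case (Suc k)
  have "summable (\<lambda>n. diffs (\<lambda>n. of_nat n ^ k) n * q ^ n)"
    using Suc by (intro termdiff_converges[of _ 1]) auto
  hence "summable (\<lambda>n. q * (diffs (\<lambda>n. of_nat n ^ k) n * q ^ n))"
    by (rule summable_mult)
  hence "summable (\<lambda>n. of_nat (Suc n) ^ Suc k * q ^ Suc n)"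
    by (simp add: diffs_def mult_ac)
  thus ?case
    by (subst (asm) summable_Suc_iff)
qed

text \<open>The derivative is described through \<open>q * D\<close> because \<open>q d/dq\<close>
  multiplies coefficients by \<open>n\<close> without moving the index, and this is what
  \<open>d/dz\<close> induces for \<open>q = exp (2 \<pi> i z)\<close>.\<close>

lemma has_field_derivative_power_series:
  fixes c :: "nat \<Rightarrow> complex"
  assumes "\<And>q. norm q < 1 \<Longrightarrow> summable (\<lambda>n. c n * q ^ n)" and "norm q < 1"
  obtains D where "((\<lambda>q. \<Sum>n. c n * q ^ n) has_field_derivative D) (at q)"
    and "q * D = (\<Sum>n. of_nat n * c n * q ^ n)"
proof
  show "((\<lambda>q. \<Sum>n. c n * q ^ n) has_field_derivative (\<Sum>n. diffs c n * q ^ n)) (at q)"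
    using assms by (intro termdiffs_strong'[of 1]) auto
  have sm: "summable (\<lambda>n. diffs c n * q ^ n)"
    using assms by (intro termdiff_converges[of _ 1]) auto
  have "q * (\<Sum>n. diffs c n * q ^ n) = (\<Sum>n. of_nat (Suc n) * c (Suc n) * q ^ Suc n)"
    using sm by (subst suminf_mult[symmetric]) (auto simp: diffs_def mult_ac)
  also have "\<dots> = (\<Sum>n. of_nat n * c n * q ^ n)"
  proof (subst suminf_split_head)
    have "summable (\<lambda>n. q * (diffs c n * q ^ n))"
      using sm by (rule summable_mult)
    hence "summable (\<lambda>n. of_nat (Suc n) * c (Suc n) * q ^ Suc n)"
      by (simp add: diffs_def mult_ac)
    thus "summable (\<lambda>n. of_nat n * c n * q ^ n)"
      by (subst (asm) summable_Suc_iff)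
  qed auto
  finally show "q * (\<Sum>n. diffs c n * q ^ n) = (\<Sum>n. of_nat n * c n * q ^ n)" .
qed

lemma norm_exp_2pi_i: "norm (exp (2 * of_real pi * \<i> * z)) = exp (- 2 * pi * Im z)"
  by simp

lemma has_field_derivative_exp_power_series:
  fixes c :: "nat \<Rightarrow> complex"
  assumes "\<And>q. norm q < 1 \<Longrightarrow> summable (\<lambda>n. c n * q ^ n)" and "Im z > 0"
  shows "((\<lambda>z. \<Sum>n. c n * exp (2 * of_real pi * \<i> * z) ^ n) has_field_derivative
     2 * of_real pi * \<i> * (\<Sum>n. of_nat n * c n * exp (2 * of_real pi * \<i> * z) ^ n)) (at z)"
proof -
  let ?q = "exp (2 * of_real pi * \<i> * z)"
  have q: "norm ?q < 1"
    using assms(2) by simp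
  obtain D where D: "((\<lambda>q. \<Sum>n. c n * q ^ n) has_field_derivative D) (at ?q)"
    "?q * D = (\<Sum>n. of_nat n * c n * ?q ^ n)"
    using has_field_derivative_power_series[OF assms(1) q] by blast
  have "((\<lambda>z. exp (2 * of_real pi * \<i> * z)) has_field_derivative 2 * of_real pi * \<i> * ?q) (at z)"
    by (auto intro!: derivative_eq_intros)
  from DERIV_chain2[OF D(1) this] show ?thesis
    unfolding D(2)[symmetric] by (simp add: mult_ac)
qed

text \<open>The divisors of \<open>0\<close> form an infinite set, over which \<open>sum\<close> is \<open>0\<close>.\<close>

lemma divisor_sigma_0 [simp]: "divisor_sigma s 0 = 0"
  by (simp add: divisor_sigma_def)

text \<open>With \<open>c = n div d\<close> the coefficient is the sum of \<open>c * d ^ k\<close>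
  over the factorizations \<open>n = c * d\<close>; this is the origin of the sum over
  \<open>c\<close> in \<open>\<Phi>\<close>.\<close>

lemma nat_times_divisor_sigma:
  assumes "k > 0"
  shows "n * divisor_sigma (k - 1) n = (\<Sum>d | d dvd n. (n div d) * d ^ k)"
proof -
  have "n * d ^ (k - 1) = (n div d) * d ^ k" if "d dvd n" for d
  proof -
    have "d ^ k = d * d ^ (k - 1)"
      using assms by (cases k) auto
    thus ?thesis
      using that by (metis dvd_div_mult_self mult.assoc)
  qed
  thus ?thesis
    by (simp add: divisor_sigma_def sum_distrib_left)
qed

text \<open>The bound \<open>1 / x^3 \<le> 1 / ((x - 1) x (x + 1))\<close> telescopes; at
  \<open>n = 1\<close> there is equality.\<close>

lemma sum_inverse_cubes_le:
  assumes "n > 0"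
  shows "(\<Sum>c=1..n. 1 / real c ^ 3) \<le> 5 / 4 - 1 / (2 * real n * (real n + 1))"
  using assms
proof (induction n rule: nat_induct_non_zero)
  case 1
  show ?case by simp
next
  case (Suc n)
  let ?x = "real (Suc n)"
  have x: "?x \<ge> 2" using Suc by simp
  have "1 / ?x ^ 3 \<le> 1 / (?x ^ 3 - ?x)"
    using x by (intro divide_left_mono mult_pos_pos)
      (auto simp: power3_eq_cube intro!: mult_pos_pos less_1_mult)
  also have "?x ^ 3 - ?x = ?x * (?x - 1) * (?x + 1)"
    by (simp add: power3_eq_cube algebra_simps)
  also have "1 / (?x * (?x - 1) * (?x + 1)) = 1 / (2 * (?x - 1) * ?x) - 1 / (2 * ?x * (?x + 1))"
    using x by (simp add: divide_simps) (simp add: algebra_simps)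
  finally show ?case
    using Suc.IH by (simp add: algebra_simps)
qed

text \<open>Writing the divisors as \<open>n div c\<close>, the left side is \<open>n ^ k\<close>
  times the sum of \<open>c ^ (1 - k)\<close> over \<open>c dvd n\<close>, which for
  \<open>k \<ge> 4\<close> is at most the sum of inverse cubes.\<close>

lemma nat_times_divisor_sigma_le:
  assumes "k \<ge> 4"
  shows "real (n * divisor_sigma (k - 1) n) \<le> 5 / 4 * real n ^ k"
proof (cases "n = 0")
  case False
  have "real (n * divisor_sigma (k - 1) n) = (\<Sum>d | d dvd n. real (n div d) * real d ^ k)"
    using assms by (subst nat_times_divisor_sigma) auto
  also have "\<dots> = (\<Sum>c | c dvd n. real c * real (n div c) ^ k)"
    by (rule sum.reindex_bij_witness[of _ "\<lambda>c. n div c" "\<lambda>c. n div c"]) (use False in auto)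
  also have "\<dots> \<le> (\<Sum>c | c dvd n. real n ^ k * (1 / real c ^ 3))"
  proof (intro sum_mono)
    fix c assume "c \<in> {c. c dvd n}"
    hence c: "c dvd n" "c > 0" using False by (auto intro: Nat.gr0I)
    have "real c * real (n div c) ^ k = real n ^ k * (real c / real c ^ k)"
      using c by (simp add: real_of_nat_div power_divide)
    also have "real c ^ k = real c ^ (k - 4) * (real c * real c ^ 3)"
      using assms by (simp flip: power_Suc power_add)
    also have "real c / (real c ^ (k - 4) * (real c * real c ^ 3)) = 1 / (real c ^ (k - 4) * real c ^ 3)"
      using c by (simp add: field_simps)
    also have "real n ^ k * \<dots> \<le> real n ^ k * (1 / real c ^ 3)"
    proof (intro mult_left_mono divide_left_mono)
      have "1 \<le> real c ^ (k - 4)" using c by (intro one_le_power) auto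
      thus "real c ^ 3 \<le> real c ^ (k - 4) * real c ^ 3"
        by (simp add: mult_le_cancel_right1)
    qed (use c in auto)
    finally show "real c * real (n div c) ^ k \<le> real n ^ k * (1 / real c ^ 3)" .
  qed
  also have "\<dots> = real n ^ k * (\<Sum>c | c dvd n. 1 / real c ^ 3)"
    by (simp add: sum_distrib_left)
  also have "\<dots> \<le> real n ^ k * (\<Sum>c=1..n. 1 / real c ^ 3)"
    using False by (intro mult_left_mono sum_mono2) (auto dest: dvd_imp_le intro!: Suc_leI Nat.gr0I)
  also have "\<dots> \<le> real n ^ k * (5 / 4)"
  proof (intro mult_left_mono)
    have "0 \<le> 1 / (2 * real n * (real n + 1))" by simp
    with sum_inverse_cubes_le[of n] False show "(\<Sum>c=1..n. 1 / real c ^ 3) \<le> 5 / 4" by linarith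
  qed auto
  finally show ?thesis by simp
qed auto

lemma nat_times_divisor_sigma_ge:
  assumes "k > 0" "n > 0"
  shows "n ^ k \<le> n * divisor_sigma (k - 1) n"
proof -
  have "(\<Sum>d\<in>{n}. (n div d) * d ^ k) \<le> (\<Sum>d | d dvd n. (n div d) * d ^ k)"
    using assms by (intro sum_mono2) auto
  thus ?thesis
    using assms by (subst nat_times_divisor_sigma) simp_all
qed

text \<open>This is \<open>P\<close>, taken as a function of \<open>q\<close> so that its zeros can
  be counted in a disc.\<close>

definition eis_deriv_series :: "nat \<Rightarrow> complex \<Rightarrow> complex" where
  "eis_deriv_series k q = (\<Sum>n. of_nat (n * divisor_sigma (k - 1) n) * q ^ n)"

lemma summable_eis_deriv_series:
  fixes q :: "'a :: {real_normed_field, banach}"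
  assumes "k \<ge> 4" "norm q < 1"
  shows "summable (\<lambda>n. norm (of_nat (n * divisor_sigma (k - 1) n) * q ^ n))"
proof (rule summable_comparison_test')
  show "summable (\<lambda>n. 5 / 4 * (of_nat n ^ k * norm q ^ n))"
    using assms by (intro summable_mult summable_power_times_geometric) auto
  fix n :: nat
  have "real (n * divisor_sigma (k - 1) n) * norm q ^ n \<le> (5 / 4 * real n ^ k) * norm q ^ n"
    using assms nat_times_divisor_sigma_le[of k n] by (intro mult_right_mono) auto
  thus "norm (norm (of_nat (n * divisor_sigma (k - 1) n) * q ^ n)) \<le> 5 / 4 * (of_nat n ^ k * norm q ^ n)"
    by (simp add: norm_mult norm_power)
qed

lemma holomorphic_eis_deriv_series:
  assumes "k \<ge> 4"
  shows "eis_deriv_series k holomorphic_on ball 0 1"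
proof -
  have "eis_deriv_series k field_differentiable at q" if q: "norm q < 1" for q
  proof -
    have "summable (\<lambda>n. of_nat (n * divisor_sigma (k - 1) n) * q ^ n)" if "norm q < 1" for q :: complex
      using summable_eis_deriv_series[OF assms that] by (rule summable_norm_cancel)
    from has_field_derivative_power_series[OF this q] show ?thesis
      unfolding eis_deriv_series_def[abs_def] field_differentiable_def by metis
  qed
  thus ?thesis
    by (auto simp: holomorphic_on_def intro: field_differentiable_at_within)
qed

lemma deriv_eisenstein_E:
  assumes "k \<ge> 4" "Im z > 0"
  shows "deriv (eisenstein_E k) z = - of_real (2 * real k / bernoulli k) * (2 * of_real pi * \<i>) *
      eis_deriv_series k (exp (2 * of_real pi * \<i> * z))"
proof -
  let ?c = "\<lambda>n. of_nat (divisor_sigma (k - 1) n) :: complex"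
  have sm: "summable (\<lambda>n. ?c n * q ^ n)" if "norm q < 1" for q
  proof (rule summable_comparison_test'[OF summable_eis_deriv_series[OF assms(1) that], of 1])
    fix n :: nat assume n: "n \<ge> 1"
    hence "real (divisor_sigma (k - 1) n) * norm q ^ n \<le> real (n * divisor_sigma (k - 1) n) * norm q ^ n"
      by (intro mult_right_mono) (auto simp: mult_le_cancel_right1)
    thus "norm (?c n * q ^ n) \<le> norm (of_nat (n * divisor_sigma (k - 1) n) * q ^ n)"
      by (simp add: norm_mult norm_power)
  qed
  have "eisenstein_E k = (\<lambda>z. 1 - of_real (2 * real k / bernoulli k) *
       (\<Sum>n. ?c (Suc n) * exp (2 * of_real pi * \<i> * z) ^ Suc n))"
    unfolding eisenstein_E_def[abs_def] by simp
  \<comment> \<open>The index shift can be undone because \<open>divisor_sigma\<close> vanishes at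
    0.\<close>
  moreover have "(\<Sum>n. ?c (Suc n) * exp (2 * of_real pi * \<i> * w) ^ Suc n) =
      (\<Sum>n. ?c n * exp (2 * of_real pi * \<i> * w) ^ n)" if "Im w > 0" for w
    by (subst suminf_split_head[OF sm]) (use that in auto)
  ultimately have eq: "eisenstein_E k w = 1 - of_real (2 * real k / bernoulli k) *
       (\<Sum>n. ?c n * exp (2 * of_real pi * \<i> * w) ^ n)" if "Im w > 0" for w
    using that by simp
  have "((\<lambda>z. 1 - of_real (2 * real k / bernoulli k) *
       (\<Sum>n. ?c n * exp (2 * of_real pi * \<i> * z) ^ n)) has_field_derivative
       - of_real (2 * real k / bernoulli k) * (2 * of_real pi * \<i>) *
      eis_deriv_series k (exp (2 * of_real pi * \<i> * z))) (at z)"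
    using DERIV_diff[OF DERIV_const DERIV_cmult[OF has_field_derivative_exp_power_series[OF sm assms(2)]],
        of 1 "of_real (2 * real k / bernoulli k)"]
    by (simp add: eis_deriv_series_def mult_ac)
  moreover have "\<forall>\<^sub>F w in nhds z. eisenstein_E k w = 1 - of_real (2 * real k / bernoulli k) *
       (\<Sum>n. ?c n * exp (2 * of_real pi * \<i> * w) ^ n)"
    using eventually_nhds_in_open[OF open_halfspace_Im_gt[of 0], of z] assms(2)
    by (auto elim!: eventually_mono simp: eq)
  ultimately have "(eisenstein_E k has_field_derivative
       - of_real (2 * real k / bernoulli k) * (2 * of_real pi * \<i>) *
      eis_deriv_series k (exp (2 * of_real pi * \<i> * z))) (at z)"
    by (subst DERIV_cong_ev[OF refl _ refl])
  thus ?thesis by (rule DERIV_imp_deriv)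
qed

section \<open>The Lipschitz formula\<close>

text \<open>
  Applying the derivation \<open>d/dz\<close> repeatedly to the partial fraction and the Fourier
  expansions of \<open>\<pi> cot (\<pi> z)\<close> gives the Lipschitz formula.
\<close>

lemma not_nonpos_Int_if_Im: "Im z \<noteq> 0 \<Longrightarrow> z \<notin> \<int>\<^sub>\<le>\<^sub>0"
  by (auto elim!: nonpos_Ints_cases)

text \<open>The logarithmic derivative of
  \<open>Gamma z * Gamma (1 - z) = \<pi> / sin (\<pi> z)\<close> gives
  \<open>\<pi> cot (\<pi> z)\<close>, here expanded in \<open>q\<close>. The final
  \<open>2 \<pi> i\<close> removes the constant term contained in
  \<open>polylog_neg 0\<close>.\<close>

lemma Digamma_reflection:
  assumes "Im z > 0"
  shows "Digamma (1 - z) - Digamma z =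
    - (of_real pi * \<i>) - 2 * of_real pi * \<i> * polylog_neg 0 (exp (2 * of_real pi * \<i> * z)) + 2 * of_real pi * \<i>"
proof -
  define q where "q = exp (2 * of_real pi * \<i> * z)"
  have z: "z \<notin> \<int>\<^sub>\<le>\<^sub>0" "1 - z \<notin> \<int>\<^sub>\<le>\<^sub>0" "Im w > 0 \<Longrightarrow> sin (of_real pi * w) \<noteq> 0" for w
  proof -
    show "sin (of_real pi * w) \<noteq> 0" if "Im w > 0"
    proof
      assume "sin (of_real pi * w) = 0"
      then obtain n :: int where "of_real pi * w = of_real (of_int n * pi)"
        by (auto simp: sin_eq_0)
      hence "Im (of_real pi * w) = 0" by simp
      thus False using that by simp
    qed
  qed (use assms in \<open>auto intro!: not_nonpos_Int_if_Im\<close>)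
  have q1: "norm q < 1" "q \<noteq> 0"
    using assms by (auto simp: q_def)
  have "((\<lambda>w. Gamma w * Gamma (1 - w)) has_field_derivative
      Gamma z * Gamma (1 - z) * (Digamma z - Digamma (1 - z))) (at z)"
    using z by (auto intro!: derivative_eq_intros simp: algebra_simps)
  moreover have "((\<lambda>w. of_real pi / sin (of_real pi * w)) has_field_derivative
      (of_real pi / sin (of_real pi * z)) * (- of_real pi * cos (of_real pi * z) / sin (of_real pi * z))) (at z)"
    using z(3)[OF assms] by (auto intro!: derivative_eq_intros simp: field_simps power2_eq_square)
  ultimately have "Gamma z * Gamma (1 - z) * (Digamma z - Digamma (1 - z)) =
      (of_real pi / sin (of_real pi * z)) * (- of_real pi * cos (of_real pi * z) / sin (of_real pi * z))"
    by (simp only: Gamma_reflection_complex) (rule DERIV_unique)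
  have "Digamma (1 - z) - Digamma z = of_real pi * (cos (of_real pi * z) / sin (of_real pi * z))"
  proof -
    have "of_real pi / sin (of_real pi * z) \<noteq> 0"
      using z(3)[OF assms] by simp
    moreover have "of_real pi / sin (of_real pi * z) * (Digamma z - Digamma (1 - z)) =
      (of_real pi / sin (of_real pi * z)) * (- of_real pi * cos (of_real pi * z) / sin (of_real pi * z))"
      using \<open>Gamma z * Gamma (1 - z) * (Digamma z - Digamma (1 - z)) = _\<close>
      unfolding Gamma_reflection_complex .
    ultimately have "Digamma z - Digamma (1 - z) = - of_real pi * cos (of_real pi * z) / sin (of_real pi * z)"
      using mult_left_cancel by blast
    thus ?thesis by (simp add: algebra_simps)
  qed
  also have "cos (of_real pi * z) / sin (of_real pi * z) = \<i> * (q + 1) / (q - 1)"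
  proof -
    define e where "e = exp (\<i> * (of_real pi * z))"
    have e: "e \<noteq> 0" "q = e ^ 2"
      by (auto simp: e_def q_def power2_eq_square mult_ac simp flip: exp_add)
    have e1: "e * e \<noteq> 1" using q1 e by (auto simp: power2_eq_square)
    have sc: "sin (of_real pi * z) = (e - 1 / e) / (2 * \<i>)" "cos (of_real pi * z) = (e + 1 / e) / 2"
      by (simp_all add: sin_exp_eq cos_exp_eq exp_minus e_def inverse_eq_divide)
    show ?thesis
      unfolding e(2) sc using e(1) e1 by (simp add: divide_simps power2_eq_square)
  qed
  also have "of_real pi * (\<i> * (q + 1) / (q - 1)) =
      - (of_real pi * \<i>) - 2 * of_real pi * \<i> * (1 / (1 - q)) + 2 * of_real pi * \<i>"
    using q1 by (auto simp: divide_simps) (simp_all add: algebra_simps)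
  also have "1 / (1 - q) = polylog_neg 0 q"
    using suminf_geometric[OF q1(1)] by (simp add: polylog_neg_def)
  finally show ?thesis unfolding q_def .
qed

lemma has_field_derivative_polylog_neg_exp:
  assumes "Im z > 0"
  shows "((\<lambda>z. polylog_neg m (exp (2 * of_real pi * \<i> * z))) has_field_derivative
     2 * of_real pi * \<i> * polylog_neg (Suc m) (exp (2 * of_real pi * \<i> * z))) (at z)"
  using has_field_derivative_exp_power_series[OF summable_power_times_geometric assms, of m]
  unfolding polylog_neg_def by (simp add: mult_ac)

lemma Polygamma_reflection:
  assumes "Im z > 0" "m > 0"
  shows "(-1) ^ m * Polygamma m (1 - z) - Polygamma m z =
    - ((2 * of_real pi * \<i>) ^ Suc m) * polylog_neg m (exp (2 * of_real pi * \<i> * z))"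
proof -
  let ?P = "\<lambda>m z. polylog_neg m (exp (2 * of_real pi * \<i> * z))"
  let ?L = "\<lambda>m z. (-1) ^ m * Polygamma m (1 - z) - Polygamma m z"
  let ?R = "\<lambda>m z. - ((2 * of_real pi * \<i>) ^ Suc m) * ?P m z"
  \<comment> \<open>The case \<open>m = 0\<close> holds only up to the constant
    \<open>\<pi> i\<close>, which the first differentiation removes.\<close>
  define c where "c = (\<lambda>m::nat. if m = 0 then of_real pi * \<i> else 0)"
  have "\<forall>z. Im z > 0 \<longrightarrow> ?L m z = ?R m z + c m" for m
  proof (induction m)
    case 0
    show ?case using Digamma_reflection by (simp add: c_def algebra_simps)
  next
    case (Suc m)
    show ?case
    proof (intro allI impI)
      fix z :: complex assume z: "Im z > 0"
      have "z \<notin> \<int>\<^sub>\<le>\<^sub>0" "1 - z \<notin> \<int>\<^sub>\<le>\<^sub>0"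
        using z by (auto intro!: not_nonpos_Int_if_Im)
      hence "(?L m has_field_derivative ?L (Suc m) z) (at z)"
        by (auto intro!: derivative_eq_intros)
      moreover have "\<forall>\<^sub>F w in nhds z. ?L m w = ?R m w + c m"
        using eventually_nhds_in_open[OF open_halfspace_Im_gt[of 0], of z] z Suc.IH
        by (auto elim!: eventually_mono)
      moreover have "((\<lambda>w. ?R m w + c m) has_field_derivative
          - ((2 * of_real pi * \<i>) ^ Suc m) * (2 * of_real pi * \<i> * ?P (Suc m) z) + 0) (at z)"
        by (intro DERIV_add DERIV_cmult has_field_derivative_polylog_neg_exp z DERIV_const)
      moreover have "- ((2 * of_real pi * \<i>) ^ Suc m) * (2 * of_real pi * \<i> * ?P (Suc m) z) + 0 = ?R (Suc m) z"
        by simp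
      ultimately have "((\<lambda>w. ?R m w + c m) has_field_derivative ?L (Suc m) z) (at z)"
          and "((\<lambda>w. ?R m w + c m) has_field_derivative ?R (Suc m) z) (at z)"
        by (simp_all only: DERIV_cong_ev[OF refl _ refl])
      hence "?L (Suc m) z = ?R (Suc m) z"
        by (rule DERIV_unique)
      thus "?L (Suc m) z = ?R (Suc m) z + c (Suc m)"
        by (simp add: c_def)
    qed
  qed
  thus ?thesis using assms by (simp add: c_def)
qed

text \<open>This is \<open>\<Sum>b. (z + b)\<^sup>-\<^sup>s\<close> over all integers \<open>b\<close>, with \<open>b = n + 1\<close> and \<open>b = - n\<close> paired.\<close>

definition lattice_line_sum :: "nat \<Rightarrow> complex \<Rightarrow> complex" where
  "lattice_line_sum s z = (\<Sum>n. 1 / (z + 1 + of_nat n) ^ s + 1 / (z - of_nat n) ^ s)"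

lemma
  assumes "Im z \<noteq> 0" "s \<ge> 2"
  shows summable_inverse_powers_right: "summable (\<lambda>n. 1 / (z + 1 + of_nat n) ^ s)"
    and summable_inverse_powers_left: "summable (\<lambda>n. 1 / (z - of_nat n) ^ s)"
proof -
  have "z + 1 \<noteq> 0" "- z \<noteq> 0" using assms by (auto simp: complex_eq_iff)
  note * = this[THEN Polygamma_converges'[OF _ assms(2)]]
  show "summable (\<lambda>n. 1 / (z + 1 + of_nat n) ^ s)"
    using *(1) by (simp add: inverse_eq_divide)
  have "1 / (z - of_nat n) ^ s = (-1) ^ s * inverse ((- z + of_nat n) ^ s)" for n
  proof -
    have "(z - of_nat n) ^ s = (-1) ^ s * (- z + of_nat n) ^ s"
      by (simp flip: power_mult_distrib)
    thus ?thesis by (cases "even s") (simp_all add: inverse_eq_divide)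
  qed
  thus "summable (\<lambda>n. 1 / (z - of_nat n) ^ s)"
    using summable_mult[OF *(2), of "(-1) ^ s"] by simp
qed

text \<open>For odd \<open>s\<close> the terms with \<open>b \<le> 0\<close> are minus inverse
  powers of \<open>- z + n\<close>, so up to \<open>fact k\<close> the two half-lines give
  \<open>Polygamma k (- z) - Polygamma k (z + 1)\<close>. This is the reflection at
  \<open>z + 1\<close>, and \<open>q\<close> has period 1.\<close>

lemma lipschitz_formula:
  assumes "Im z > 0" "odd s" "s \<ge> 2"
  shows "lattice_line_sum s z =
    - ((2 * of_real pi * \<i>) ^ s) / fact (s - 1) * polylog_neg (s - 1) (exp (2 * of_real pi * \<i> * z))"
proof -
  define k where "k = s - 1"
  have s: "s = Suc k" "k > 0" "even k" using assms by (auto simp: k_def)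
  have z: "Im z \<noteq> 0" using assms by simp
  let ?H = "\<lambda>w::complex. \<Sum>n. inverse ((w + of_nat n) ^ s)"
  have P: "Polygamma k w = - fact k * ?H w" for w
    using s by (simp add: Polygamma_def)
  have "lattice_line_sum s z = (\<Sum>n. 1 / (z + 1 + of_nat n) ^ s) + (\<Sum>n. 1 / (z - of_nat n) ^ s)"
    unfolding lattice_line_sum_def using z assms
    by (intro suminf_add[symmetric] summable_inverse_powers_left summable_inverse_powers_right)
  also have "(\<Sum>n. 1 / (z - of_nat n) ^ s) = (\<Sum>n. - inverse ((- z + of_nat n) ^ s))"
  proof (intro suminf_cong)
    fix n
    have "(z - of_nat n) ^ s = - ((- z + of_nat n) ^ s)"
      using power_minus_odd[OF assms(2), of "- z + of_nat n"] by simp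
    thus "1 / (z - of_nat n) ^ s = - inverse ((- z + of_nat n) ^ s)"
      by (simp add: inverse_eq_divide)
  qed
  also have "\<dots> = - ?H (- z)"
    using z assms by (intro suminf_minus Polygamma_converges') auto
  also have "(\<Sum>n. 1 / (z + 1 + of_nat n) ^ s) + - ?H (- z) = (Polygamma k (- z) - Polygamma k (z + 1)) / fact k"
    unfolding P by (simp add: field_simps)
  also have "Polygamma k (- z) - Polygamma k (z + 1) =
      - ((2 * of_real pi * \<i>) ^ Suc k) * polylog_neg k (exp (2 * of_real pi * \<i> * (z + 1)))"
    using Polygamma_reflection[of "z + 1" k] s assms by simp
  also have "exp (2 * of_real pi * \<i> * (z + 1)) = exp (2 * of_real pi * \<i> * z)"
    by (simp add: distrib_left exp_add)
  finally show ?thesis by (simp add: s)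
qed

section \<open>Comparison with the first row of the lattice sum\<close>

text \<open>The partial sum runs over pairs with \<open>c * d < N\<close>. These lie in a square,
  and the sum over \<open>d\<close> is then extended to infinity. As all terms are nonnegative, no
  double series has to be rearranged.\<close>

lemma sum_eis_deriv_series_le:
  fixes x :: real
  assumes "k > 0" "0 \<le> x" "x < 1"
  shows "(\<Sum>n<N. real (n * divisor_sigma (k - 1) n) * x ^ n)
    \<le> (\<Sum>c=1..N. real c * (\<Sum>d. real d ^ k * (x ^ c) ^ d))"
proof -
  define f where "f = (\<lambda>(c, d). real c * (real d ^ k * (x ^ c) ^ d))"
  have "(\<Sum>n<N. real (n * divisor_sigma (k - 1) n) * x ^ n) =
      (\<Sum>n\<in>{1..<N}. real (n * divisor_sigma (k - 1) n) * x ^ n)"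
    by (intro sum.mono_neutral_right) auto
  also have "\<dots> = (\<Sum>n\<in>{1..<N}. \<Sum>d | d dvd n. f (n div d, d))"
  proof (intro sum.cong refl)
    fix n assume n: "n \<in> {1..<N}"
    have eq: "real (n div d) * (real d ^ k * (x ^ (n div d)) ^ d) = real (n div d * d ^ k) * x ^ n"
      if "d dvd n" for d
      using that by (simp flip: power_mult)
    have "(\<Sum>d | d dvd n. real (n div d * d ^ k) * x ^ n) = (\<Sum>d | d dvd n. f (n div d, d))"
      by (intro sum.cong refl) (simp only: f_def prod.case mem_Collect_eq eq)
    thus "real (n * divisor_sigma (k - 1) n) * x ^ n = (\<Sum>d | d dvd n. f (n div d, d))"
      unfolding nat_times_divisor_sigma[OF assms(1)] by (simp add: sum_distrib_right)
  qed
  also have "\<dots> = (\<Sum>p\<in>(SIGMA n:{1..<N}. {d. d dvd n}). f (fst p div snd p, snd p))"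
    by (subst sum.Sigma) (auto simp: case_prod_beta)
  also have "\<dots> = sum f ((\<lambda>p. (fst p div snd p, snd p)) ` (SIGMA n:{1..<N}. {d. d dvd n}))"
  proof (subst sum.reindex)
    show "inj_on (\<lambda>p. (fst p div snd p, snd p)) (SIGMA n:{1..<N}. {d. d dvd n})"
      by (auto intro!: inj_onI dest: dvd_div_eq_cancel)
  qed simp
  also have "\<dots> \<le> sum f ({1..N} \<times> {1..N})"
  proof (intro sum_mono2)
    show "(\<lambda>p. (fst p div snd p, snd p)) ` (SIGMA n:{1..<N}. {d. d dvd n}) \<subseteq> {1..N} \<times> {1..N}"
    proof (clarsimp, intro conjI)
      fix n d :: nat assume *: "Suc 0 \<le> n" "n < N" "d dvd n"
      hence "d > 0" "d \<le> n" by (auto intro: Nat.gr0I dest: dvd_imp_le)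
      thus "Suc 0 \<le> n div d" "n div d \<le> N" "Suc 0 \<le> d" "d \<le> N"
        using * by (auto simp: Suc_le_eq div_greater_zero_iff intro: le_trans[OF div_le_dividend])
    qed
  qed (use assms in \<open>auto simp: f_def\<close>)
  also have "\<dots> = (\<Sum>c=1..N. real c * (\<Sum>d=1..N. real d ^ k * (x ^ c) ^ d))"
    by (simp add: f_def sum.cartesian_product[symmetric] sum_distrib_left)
  also have "\<dots> \<le> (\<Sum>c=1..N. real c * (\<Sum>d. real d ^ k * (x ^ c) ^ d))"
  proof (intro sum_mono mult_left_mono sum_le_suminf)
    fix c assume "c \<in> {1..N}"
    hence "x ^ c < 1" using assms by (simp add: power_less_one_iff)
    thus "summable (\<lambda>d. real d ^ k * (x ^ c) ^ d)"
      using summable_power_times_geometric[of "x ^ c" k] assms by simp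
  qed (use assms in auto)
  finally show ?thesis .
qed

text \<open>Bernoulli's inequality with exponent \<open>s / 2\<close>, squared because
  \<open>s\<close> is odd in the applications.\<close>

lemma one_plus_half_power_le:
  fixes X :: real
  assumes "X \<ge> 0" "s \<ge> 2"
  shows "(1 + real s * X / 2) ^ 2 \<le> (1 + X) ^ s"
  using assms(2)
proof (induction s rule: dec_induct)
  case base
  show ?case by simp
next
  case (step s)
  have "(1 + real (Suc s) * X / 2) ^ 2 \<le> (1 + X) * (1 + real s * X / 2) ^ 2"
  proof -
    have "(1 + X) * (1 + real s * X / 2) ^ 2 - (1 + real (Suc s) * X / 2) ^ 2 =
        (real s - 1) * X ^ 2 / 2 + X ^ 2 / 4 + real s ^ 2 * X ^ 3 / 4"
      by (simp add: power2_eq_square power3_eq_cube field_simps)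
    also have "\<dots> \<ge> 0"
      using step assms by (intro add_nonneg_nonneg) auto
    finally show ?thesis by simp
  qed
  also have "\<dots> \<le> (1 + X) * (1 + X) ^ s"
    using step assms by (intro mult_left_mono) auto
  finally show ?case by simp
qed

text \<open>Turns a comparison of squared moduli, the form in which distances of lattice points are
  computed, into one of \<open>s\<close>-th powers with a gain linear in \<open>s\<close>.\<close>

lemma power_ge_if_square_ge:
  fixes r t X :: real
  assumes "(1 + X) * r ^ 2 \<le> t ^ 2" "X \<ge> 0" "r \<ge> 0" "t \<ge> 0" "s \<ge> 2"
  shows "(1 + real s * X / 2) * r ^ s \<le> t ^ s"
proof (rule power2_le_imp_le)
  have "((1 + real s * X / 2) * r ^ s) ^ 2 = (1 + real s * X / 2) ^ 2 * (r ^ 2) ^ s"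
    by (simp add: power_mult_distrib mult.commute flip: power_mult)
  also have "\<dots> \<le> (1 + X) ^ s * (r ^ 2) ^ s"
    using assms by (intro mult_right_mono one_plus_half_power_le) auto
  also have "\<dots> = ((1 + X) * r ^ 2) ^ s"
    by (simp add: power_mult_distrib)
  also have "\<dots> \<le> (t ^ 2) ^ s"
    using assms by (intro power_mono) auto
  finally show "((1 + real s * X / 2) * r ^ s) ^ 2 \<le> (t ^ s) ^ 2"
    by (simp add: mult.commute flip: power_mult)
qed (use assms in auto)

lemma lattice_line_sum_split:
  assumes "Im z \<noteq> 0" "s \<ge> 2"
  shows "lattice_line_sum s z = 1 / z ^ s + ((\<Sum>n. 1 / (z + 1 + of_nat n) ^ s) + (\<Sum>n. 1 / (z - 1 - of_nat n) ^ s))"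
proof -
  note sm = summable_inverse_powers_right[OF assms] summable_inverse_powers_left[OF assms]
  have "lattice_line_sum s z = (\<Sum>n. 1 / (z + 1 + of_nat n) ^ s) + (\<Sum>n. 1 / (z - of_nat n) ^ s)"
    unfolding lattice_line_sum_def by (intro suminf_add[symmetric] sm)
  also have "(\<Sum>n. 1 / (z - of_nat n) ^ s) = 1 / z ^ s + (\<Sum>n. 1 / (z - 1 - of_nat n) ^ s)"
    using suminf_split_head[OF sm(2)] by (simp add: algebra_simps)
  finally show ?thesis by simp
qed

lemma suminf_inverse_squares: "summable (\<lambda>n. C / (real n + 1) ^ 2)" "(\<Sum>n. C / (real n + 1) ^ 2) = C * pi ^ 2 / 6"
  using sums_mult[OF inverse_squares_sums, of C] by (auto simp: sums_iff add_ac)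

lemma norm_suminf_inverse_squares_le:
  fixes f :: "nat \<Rightarrow> complex"
  assumes "\<And>n. norm (f n) \<le> C / (real n + 1) ^ 2"
  shows "norm (\<Sum>n. f n) \<le> C * pi ^ 2 / 6"
  using norm_suminf_le[OF assms suminf_inverse_squares(1)] by (simp add: suminf_inverse_squares)

text \<open>For \<open>b \<noteq> 0\<close> the squared modulus is \<open>a^2 + b^2\<close>, and
  \<open>C * a ^ 2 \<le> real s / 2\<close> makes the \<open>s\<close>-th power at least
  \<open>C b^2 a^s\<close>. Summing \<open>1 / b^2\<close> on both sides gives
  \<open>\<pi>^2 / 3\<close>.\<close>

lemma norm_lattice_line_sum_imaginary_le:
  fixes a C :: real
  assumes "a > 0" "s \<ge> 2" "C * a ^ 2 \<le> real s / 2" "C > 0"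
  shows "norm (lattice_line_sum s (\<i> * of_real a)) \<le> (1 + pi ^ 2 / (3 * C)) / a ^ s"
proof -
  have bound: "norm (1 / w ^ s) \<le> (1 / (C * a ^ s)) / (real n + 1) ^ 2"
    if "norm w ^ 2 = a ^ 2 + (real n + 1) ^ 2" for w :: complex and n
  proof -
    define X where "X = (real n + 1) ^ 2 / a ^ 2"
    have X: "(1 + X) * a ^ 2 \<le> norm w ^ 2" "X \<ge> 0"
      using assms that by (auto simp: X_def field_simps)
    have "C * (real n + 1) ^ 2 * a ^ 2 \<le> real s / 2 * (real n + 1) ^ 2"
      using mult_right_mono[OF assms(3), of "(real n + 1) ^ 2"] by (simp add: mult_ac)
    hence "C * (real n + 1) ^ 2 \<le> real s * X / 2"
      using assms by (simp add: X_def field_simps)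
    hence "C * (real n + 1) ^ 2 * a ^ s \<le> (1 + real s * X / 2) * a ^ s"
      using assms by (intro mult_right_mono) auto
    also have "\<dots> \<le> norm w ^ s"
      using X assms by (intro power_ge_if_square_ge) auto
    finally have "1 / norm w ^ s \<le> 1 / (C * (real n + 1) ^ 2 * a ^ s)"
      using assms by (intro divide_left_mono mult_pos_pos) (auto intro: less_le_trans[rotated] mult_pos_pos zero_less_power)
    thus ?thesis by (simp add: norm_divide norm_power mult_ac)
  qed
  have A: "norm (1 / (\<i> * of_real a :: complex) ^ s) \<le> 1 / a ^ s"
    using assms by (simp add: norm_divide norm_power norm_mult)
  have B: "norm (\<Sum>n. 1 / (\<i> * of_real a + 1 + of_nat n :: complex) ^ s) \<le> (1 / (C * a ^ s)) * pi ^ 2 / 6"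
    by (intro norm_suminf_inverse_squares_le bound) (auto simp: cmod_power2 algebra_simps)
  have B': "norm (\<Sum>n. 1 / (\<i> * of_real a - 1 - of_nat n :: complex) ^ s) \<le> (1 / (C * a ^ s)) * pi ^ 2 / 6"
    by (intro norm_suminf_inverse_squares_le bound) (auto simp: cmod_power2, simp add: power2_eq_square algebra_simps)
  have "norm (lattice_line_sum s (\<i> * of_real a)) \<le> 1 / a ^ s + ((1 / (C * a ^ s)) * pi ^ 2 / 6 + (1 / (C * a ^ s)) * pi ^ 2 / 6)"
    using assms by (subst lattice_line_sum_split[of _ s]) (simp_all only: norm_triangle_mono[OF A norm_triangle_mono[OF B B']], auto)
  also have "\<dots> = (1 + pi ^ 2 / (3 * C)) / a ^ s"
    using assms by (simp add: field_simps)
  finally show ?thesis .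
qed

text \<open>By the Lipschitz formula this is \<open>\<Phi>(z) = \<Sum>c\<ge>1. c * lattice_line_sum s (c z)\<close>.\<close>

definition scaled_eis :: "nat \<Rightarrow> complex \<Rightarrow> complex" where
  "scaled_eis s z = - ((2 * of_real pi * \<i>) ^ s) / fact (s - 1) *
     eis_deriv_series (s - 1) (exp (2 * of_real pi * \<i> * z))"

text \<open>The coefficients of \<open>P\<close> minus those of the polylogarithm are nonnegative,
  so the difference is largest at the positive number \<open>norm q\<close>, that is at
  \<open>i Im z\<close>. There the Lipschitz formula turns the part of each \<open>c \<ge> 2\<close>
  into a line sum on the imaginary axis. The hypothesis is on finite sums, so that no convergence in
  \<open>c\<close> has to be shown.\<close>

lemma norm_scaled_eis_minus_lattice_line_sum_le:
  fixes B :: real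
  assumes "Im z > 0" "odd s" "s \<ge> 5"
  assumes B: "\<And>N. (\<Sum>c=2..N. real c * norm (lattice_line_sum s (\<i> * of_real (real c * Im z)))) \<le> B"
  shows "norm (scaled_eis s z - lattice_line_sum s z) \<le> B"
proof -
  define k where "k = s - 1"
  have k: "k \<ge> 4" "k > 0" using assms by (auto simp: k_def)
  define \<kappa> where "\<kappa> = - ((2 * of_real pi * \<i>) ^ s) / (fact k :: complex)"
  define q where "q = exp (2 * of_real pi * \<i> * z)"
  define x where "x = norm q"
  have x: "0 < x" "x < 1"
    using assms(1) by (auto simp: x_def q_def)
  define a where "a = (\<lambda>n. n * divisor_sigma (k - 1) n)"
  have sma: "summable (\<lambda>n. real (a n) * x ^ n)"
    using summable_eis_deriv_series[OF k(1), of x] x by (simp add: a_def summable_norm_cancel)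
  have smp: "summable (\<lambda>n. real n ^ k * x ^ n)"
    using summable_power_times_geometric[of x k] x by simp
  have q1: "norm q < 1" using x by (simp add: x_def)
  have "eis_deriv_series k q - polylog_neg k q = (\<Sum>n. of_nat (a n) * q ^ n - of_nat n ^ k * q ^ n)"
    unfolding eis_deriv_series_def polylog_neg_def a_def
    using summable_norm_cancel[OF summable_eis_deriv_series[OF k(1) q1]] summable_power_times_geometric[OF q1]
    by (intro suminf_diff) auto
  also have "norm \<dots> \<le> (\<Sum>n. real (a n) * x ^ n - real n ^ k * x ^ n)"
  proof (intro norm_suminf_le summable_diff sma smp)
    fix n
    have "n ^ k \<le> a n"
      using nat_times_divisor_sigma_ge[OF k(2), of n] k by (cases "n = 0") (auto simp: a_def)
    hence eq: "(of_nat (a n) * q ^ n - of_nat n ^ k * q ^ n :: complex) = of_nat (a n - n ^ k) * q ^ n"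
      by (simp add: of_nat_diff algebra_simps)
    show "norm (of_nat (a n) * q ^ n - of_nat n ^ k * q ^ n) \<le> real (a n) * x ^ n - real n ^ k * x ^ n"
      unfolding eq norm_mult norm_of_nat using \<open>n ^ k \<le> a n\<close>
      by (simp add: norm_power x_def of_nat_diff algebra_simps)
  qed
  also have "\<dots> = (\<Sum>n. real (a n) * x ^ n) - (\<Sum>n. real n ^ k * x ^ n)"
    by (intro suminf_diff[symmetric] sma smp)
  finally have 1: "norm (eis_deriv_series k q - polylog_neg k q) \<le>
    (\<Sum>n. real (a n) * x ^ n) - (\<Sum>n. real n ^ k * x ^ n)" .

  have L: "norm \<kappa> * (\<Sum>d. real d ^ k * (x ^ c) ^ d) = norm (lattice_line_sum s (\<i> * of_real (real c * Im z)))"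
    if "c > 0" for c
  proof -
    have xc: "x ^ c < 1" "0 \<le> x ^ c" using x that by (auto simp: power_less_one_iff)
    have smc: "summable (\<lambda>d. real d ^ k * (x ^ c) ^ d)"
      using summable_power_times_geometric[of "x ^ c" k] xc by simp
    have "2 * of_real pi * \<i> * (\<i> * of_real (real c * Im z)) = of_real (real c * (- 2 * pi * Im z))"
      by (simp add: complex_eq_iff)
    moreover have "x = exp (- 2 * pi * Im z)"
      unfolding x_def q_def by (rule norm_exp_2pi_i)
    ultimately have "exp (2 * of_real pi * \<i> * (\<i> * of_real (real c * Im z))) = of_real (x ^ c)"
      by (simp only: exp_of_real exp_of_nat_mult)
    hence "lattice_line_sum s (\<i> * of_real (real c * Im z)) = \<kappa> * polylog_neg k (of_real (x ^ c))"
      using assms that by (subst lipschitz_formula) (auto simp: \<kappa>_def k_def)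
    also have "polylog_neg k (of_real (x ^ c)) = of_real (\<Sum>d. real d ^ k * (x ^ c) ^ d)"
      unfolding polylog_neg_def by (simp add: suminf_of_real[OF smc])
    finally show ?thesis
      using xc by (simp add: norm_mult suminf_nonneg[OF smc])
  qed
  have "norm \<kappa> * ((\<Sum>n. real (a n) * x ^ n) - (\<Sum>n. real n ^ k * x ^ n)) \<le> B"
  proof -
    have "norm \<kappa> * (\<Sum>n<N. real (a n) * x ^ n) \<le> norm \<kappa> * (\<Sum>d. real d ^ k * x ^ d) + B" for N
    proof -
      have "norm \<kappa> * (\<Sum>n<N. real (a n) * x ^ n) \<le> norm \<kappa> * (\<Sum>n<Suc N. real (a n) * x ^ n)"
        using x by (intro mult_left_mono) auto
      also have "\<dots> \<le> norm \<kappa> * (\<Sum>c=1..Suc N. real c * (\<Sum>d. real d ^ k * (x ^ c) ^ d))"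
        unfolding a_def using k x by (intro mult_left_mono sum_eis_deriv_series_le) auto
      also have "\<dots> = (\<Sum>c=1..Suc N. real c * (norm \<kappa> * (\<Sum>d. real d ^ k * (x ^ c) ^ d)))"
        by (simp only: sum_distrib_left mult.left_commute)
      also have "\<dots> = norm \<kappa> * (\<Sum>d. real d ^ k * x ^ d) +
          (\<Sum>c=2..Suc N. real c * (norm \<kappa> * (\<Sum>d. real d ^ k * (x ^ c) ^ d)))"
        by (subst sum.atLeast_Suc_atMost) (auto simp: numeral_2_eq_2)
      also have "(\<Sum>c=2..Suc N. real c * (norm \<kappa> * (\<Sum>d. real d ^ k * (x ^ c) ^ d))) =
          (\<Sum>c=2..Suc N. real c * norm (lattice_line_sum s (\<i> * of_real (real c * Im z))))"
        by (intro sum.cong refl arg_cong2[of _ _ _ _ "(*)"] L) auto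
      finally show ?thesis using B[of "Suc N"] by linarith
    qed
    moreover have "(\<lambda>N. norm \<kappa> * (\<Sum>n<N. real (a n) * x ^ n)) \<longlonglongrightarrow> norm \<kappa> * (\<Sum>n. real (a n) * x ^ n)"
      using sma by (intro tendsto_mult_left summable_LIMSEQ)
    ultimately have "norm \<kappa> * (\<Sum>n. real (a n) * x ^ n) \<le> norm \<kappa> * (\<Sum>d. real d ^ k * x ^ d) + B"
      by (intro LIMSEQ_le_const2) auto
    thus ?thesis by (simp add: algebra_simps)
  qed
  moreover have "scaled_eis s z - lattice_line_sum s z = \<kappa> * (eis_deriv_series k q - polylog_neg k q)"
    using assms by (subst lipschitz_formula) (auto simp: scaled_eis_def \<kappa>_def k_def q_def algebra_simps)
  ultimately show ?thesis
    using mult_left_mono[OF 1, of "norm \<kappa>"] by (simp add: norm_mult)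
qed

text \<open>The term \<open>c = 2\<close> is kept exactly; for \<open>x \<ge> 3\<close> the bound
  \<open>x^6 \<ge> 81 x (x - 1)\<close> telescopes.\<close>

lemma sum_inverse_sixth_powers_le:
  assumes "N \<ge> 2"
  shows "(\<Sum>c=2..N. 1 / real c ^ 6) \<le> 1 / 64 + 1 / 162 - 1 / (81 * real N)"
  using assms
proof (induction N rule: dec_induct)
  case base
  show ?case by simp
next
  case (step n)
  define x where "x = real (Suc n)"
  have x: "x \<ge> 3" "real n = x - 1" using step by (auto simp: x_def)
  have "81 * (x * (x - 1)) \<le> x ^ 4 * (x * x)"
  proof (intro mult_mono)
    have "(3::real) ^ 4 \<le> x ^ 4" using x by (intro power_mono) auto
    thus "81 \<le> x ^ 4" by simp
  qed (use x in \<open>auto intro!: mult_left_mono\<close>)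
  also have "\<dots> = x ^ 6"
    by (simp add: eval_nat_numeral mult_ac)
  finally have "1 / x ^ 6 \<le> 1 / (81 * (x * (x - 1)))"
    using x by (intro divide_left_mono mult_pos_pos) auto
  also have "\<dots> = 1 / (81 * real n) - 1 / (81 * x)"
    unfolding x(2) using x(1) by (simp add: field_simps)
  finally show ?case
    using step by (simp add: x_def)
qed

lemma pi_square_le: "pi ^ 2 \<le> 987 / 100"
proof -
  have "pi ^ 2 \<le> 3.1416 ^ 2" using pi_approx by (intro power_mono) auto
  also have "\<dots> \<le> 987 / 100" by (simp add: power2_eq_square)
  finally show ?thesis .
qed

text \<open>
  The sum of the terms with \<open>c \<ge> 2\<close> is at most
  \<open>\<Sum>c\<ge>2. c (\<bar>z\<bar> / (c y))\<^sup>s (1 + \<pi>\<^sup>2 c\<^sup>2 / 12)\<close>, where \<open>\<bar>z\<bar> / (2 y) \<le> 0.676\<close>. The value \<open>9 / 25\<close>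
  leaves just enough room below \<open>3 / 5\<close>, a lower bound for the real part of the two
  main terms on the segment.
\<close>

lemma norm_scaled_eis_error_le:
  assumes "odd s" "s \<ge> 9" "Im z \<ge> 11 / 20" "(Im z)\<^sup>2 \<le> real s / 8" "(norm z)\<^sup>2 \<le> (Im z)\<^sup>2 + 1 / 4"
  shows "norm (z ^ s * (scaled_eis s z - lattice_line_sum s z)) \<le> 9 / 25"
proof -
  define y where "y = Im z"
  have y: "y > 0" "y \<ge> 11 / 20" using assms by (auto simp: y_def)
  define t where "t = norm z / (2 * y)"
  \<comment> \<open>The worst case of \<open>t^2 \<le> 1/4 + 1/(16 y^2)\<close> is
    \<open>y = 11/20\<close>.\<close>
  have t: "0 \<le> t" "t \<le> 0.676"
  proof -
    have "121 / 400 \<le> y ^ 2"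
      using power_mono[OF y(2), of 2] by (simp add: power2_eq_square)
    hence "norm z ^ 2 \<le> (0.676 * (2 * y)) ^ 2"
      using assms(5) by (simp add: y_def power_mult_distrib power2_eq_square)
    hence "norm z \<le> 0.676 * (2 * y)"
      using y by (intro power2_le_imp_le[of "norm z"]) auto
    thus "0 \<le> t" "t \<le> 0.676"
      using y by (auto simp: t_def field_simps)
  qed
  have ts: "t ^ s \<le> 0.0295"
  proof -
    have "t ^ s \<le> t ^ 9" using t assms by (intro power_decreasing) auto
    also have "\<dots> \<le> 0.676 ^ 9" using t by (intro power_mono) auto
    also have "\<dots> \<le> 0.0295" by (simp add: power_def eval_nat_numeral)
    finally show ?thesis .
  qed
  have le: "norm z ^ s * (real c * norm (lattice_line_sum s (\<i> * of_real (real c * y)))) \<le> 0.0295 * 550 * (1 / real c ^ 6)"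
    if c: "c \<ge> 2" for c
  proof -
    have "norm (lattice_line_sum s (\<i> * of_real (real c * y))) \<le>
        (1 + pi ^ 2 / (3 * (4 / real c ^ 2))) / (real c * y) ^ s"
    proof (rule norm_lattice_line_sum_imaginary_le)
      show "4 / real c ^ 2 * (real c * y) ^ 2 \<le> real s / 2"
        using assms(4) c by (simp add: power_mult_distrib y_def)
    qed (use c y assms in auto)
    \<comment> \<open>Here \<open>1 \<le> c^2 / 4\<close> and
      \<open>\<pi>^2 / 12 \<le> 0.8225\<close>.\<close>
    also have "1 + pi ^ 2 / (3 * (4 / real c ^ 2)) \<le> 1.0725 * real c ^ 2"
    proof -
      have "pi ^ 2 * real c ^ 2 \<le> 987 / 100 * real c ^ 2"
        using pi_square_le by (intro mult_right_mono) auto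
      moreover have "2 ^ 2 \<le> real c ^ 2"
        using c by (intro power_mono) auto
      ultimately show ?thesis by (simp add: field_simps)
    qed
    finally have "norm z ^ s * (real c * norm (lattice_line_sum s (\<i> * of_real (real c * y)))) \<le>
        norm z ^ s * (real c * (1.0725 * real c ^ 2 / (real c * y) ^ s))"
      using y c by (intro mult_left_mono) (auto simp: divide_right_mono)
    also have "\<dots> = 1.0725 * t ^ s * (2 ^ s * real c ^ 3 / real c ^ s)"
      using y by (simp add: t_def power_mult_distrib power_divide power2_eq_square power3_eq_cube field_simps)
    \<comment> \<open>Nine of the \<open>s\<close> factors supply the decay in \<open>c\<close>; the
      others are at most 1 because \<open>c \<ge> 2\<close>.\<close>
    also have "2 ^ s * real c ^ 3 / real c ^ s = (2 / real c) ^ (s - 9) * (512 / real c ^ 6)"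
    proof -
      have e: "2 ^ s = 2 ^ (s - 9) * (2 ^ 9 :: real)" "real c ^ s = real c ^ (s - 9) * real c ^ 9"
        using assms(2) by (simp_all only: power_add[symmetric] le_add_diff_inverse2)
      have e': "real c ^ 9 = real c ^ 3 * real c ^ 6"
        by (simp flip: power_add)
      have cancel: "A * 2 ^ 9 * u / (v * (u * w)) = A / v * (512 / w)" if "u \<noteq> 0" for A u v w :: real
        using that by simp
      show ?thesis
        unfolding e e' power_divide by (rule cancel) (use c in simp)
    qed
    also have "1.0725 * t ^ s * \<dots> \<le> 1.0725 * 0.0295 * (1 * (512 / real c ^ 6))"
      using ts t c by (intro mult_mono power_le_one) auto
    also have "\<dots> \<le> 0.0295 * 550 * (1 / real c ^ 6)"
      using c by (simp add: field_simps)
    finally show ?thesis .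
  qed
  show ?thesis
  proof (cases "norm z = 0")
    case False
    have "norm (scaled_eis s z - lattice_line_sum s z) \<le> (9 / 25) / norm z ^ s"
    proof (rule norm_scaled_eis_minus_lattice_line_sum_le)
      fix N :: nat
      have "norm z ^ s * (\<Sum>c=2..N. real c * norm (lattice_line_sum s (\<i> * of_real (real c * y))))
          \<le> (\<Sum>c=2..N. 0.0295 * 550 * (1 / real c ^ 6))"
        unfolding sum_distrib_left by (intro sum_mono le) auto
      also have "\<dots> = 0.0295 * 550 * (\<Sum>c=2..N. 1 / real c ^ 6)"
        by (simp only: sum_distrib_left)
      also have "\<dots> \<le> 9 / 25"
      proof (cases "N \<ge> 2")
        case True
        have "0 \<le> 1 / (81 * real N)" by simp
        with sum_inverse_sixth_powers_le[OF True]
        have "(\<Sum>c=2..N. 1 / real c ^ 6) \<le> 1 / 64 + 1 / 162" by linarith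
        thus ?thesis by simp
      qed auto
      finally show "(\<Sum>c=2..N. real c * norm (lattice_line_sum s (\<i> * of_real (real c * Im z)))) \<le> (9 / 25) / norm z ^ s"
        using False by (simp add: y_def field_simps)
    qed (use assms y in \<open>auto simp: y_def\<close>)
    thus ?thesis
      unfolding norm_mult norm_power using False by (simp add: pos_le_divide_eq mult_ac)
  qed (use assms in auto)
qed

section \<open>Positivity on the edge and on the segment\<close>

text \<open>The terms \<open>b = 0\<close> and \<open>b = 1\<close> are split off because they have
  equal modulus on \<open>Re z = -1/2\<close>; both remaining half-lines are compared with
  \<open>1 / (n + 1)^2\<close>.\<close>

lemma norm_lattice_line_sum_tail_le:
  assumes "Im z \<noteq> 0" "s \<ge> 2" "C > 0"
  assumes bound: "\<And>n w. w \<in> {z + 2 + of_nat n, z - 1 - of_nat n} \<Longrightarrow> C * (real n + 1) ^ 2 * norm z ^ s \<le> norm w ^ s"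
  shows "norm (z ^ s * lattice_line_sum s z - (1 + (z / (z + 1)) ^ s)) \<le> pi ^ 2 / (3 * C)"
proof -
  have z: "z \<noteq> 0" using assms(1) by auto
  let ?A = "\<Sum>n. z ^ s / (z + 2 + of_nat n) ^ s" and ?B = "\<Sum>n. z ^ s / (z - 1 - of_nat n) ^ s"
  have sm1: "summable (\<lambda>n. 1 / (z + 2 + of_nat n) ^ s)"
    using summable_inverse_powers_right[of "z + 1" s] assms by (simp add: add.assoc)
  have sm2: "summable (\<lambda>n. 1 / (z - 1 - of_nat n) ^ s)"
    using summable_inverse_powers_left[of "z - 1" s] assms by simp
  have "(\<Sum>n. 1 / (z + 1 + of_nat n) ^ s) = 1 / (z + 1) ^ s + (\<Sum>n. 1 / (z + 2 + of_nat n) ^ s)"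
    using suminf_split_head[OF summable_inverse_powers_right[OF assms(1,2)]] by (simp add: add_ac)
  hence "lattice_line_sum s z =
    1 / z ^ s + 1 / (z + 1) ^ s + ((\<Sum>n. 1 / (z + 2 + of_nat n) ^ s) + (\<Sum>n. 1 / (z - 1 - of_nat n) ^ s))"
    using lattice_line_sum_split[OF assms(1,2)] by simp
  hence "z ^ s * lattice_line_sum s z - (1 + (z / (z + 1)) ^ s) = ?A + ?B"
    using z suminf_mult[OF sm1, of "z ^ s"] suminf_mult[OF sm2, of "z ^ s"]
    by (simp add: distrib_left power_divide)
  moreover have le: "norm (z ^ s / w ^ s) \<le> (1 / C) / (real n + 1) ^ 2"
    if "w \<in> {z + 2 + of_nat n, z - 1 - of_nat n}" for n w
  proof -
    have "Im w \<noteq> 0" using that assms(1) by auto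
    hence "w \<noteq> 0" by auto
    thus ?thesis
      using bound[OF that] assms(3) by (simp add: norm_divide norm_power field_simps)
  qed
  have "norm ?A \<le> (1 / C) * pi ^ 2 / 6" "norm ?B \<le> (1 / C) * pi ^ 2 / 6"
    by (intro norm_suminf_inverse_squares_le le; simp)+
  ultimately show ?thesis
    using norm_triangle_ineq[of ?A ?B] by simp
qed

text \<open>On the left half of the strip, \<open>b = n + 2\<close> adds
  \<open>(n + 2) (n + 2 + 2 Re z)\<close> with second factor at least \<open>n + 1\<close>, and for
  \<open>b = - (n + 1)\<close> the cross term is nonnegative.\<close>

lemma norm_shift_square_ge:
  assumes "- 1 / 2 \<le> Re z" "Re z \<le> 0" "w \<in> {z + 2 + of_nat n, z - 1 - of_nat n}"
  shows "norm z ^ 2 + (real n + 1) ^ 2 \<le> norm w ^ 2"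
proof -
  have "norm z ^ 2 + (real n + 1) ^ 2 \<le> norm (z + 2 + of_nat n) ^ 2"
  proof -
    have "norm (z + 2 + of_nat n) ^ 2 = norm z ^ 2 + (real n + 2) * (real n + 2 + 2 * Re z)"
      unfolding cmod_power2 by (simp add: power2_eq_square algebra_simps)
    moreover have "(real n + 1) * (real n + 1) \<le> (real n + 2) * (real n + 2 + 2 * Re z)"
      using assms by (intro mult_mono) auto
    ultimately show ?thesis by (simp add: power2_eq_square)
  qed
  moreover have "norm z ^ 2 + (real n + 1) ^ 2 \<le> norm (z - 1 - of_nat n) ^ 2"
  proof -
    have "norm (z - 1 - of_nat n) ^ 2 = norm z ^ 2 + (real n + 1) ^ 2 - 2 * Re z * (real n + 1)"
      unfolding cmod_power2 by (simp add: power2_eq_square algebra_simps)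
    thus ?thesis using assms by (simp add: mult_nonpos_nonneg)
  qed
  ultimately show ?thesis using assms(3) by auto
qed

text \<open>Equal phase makes the main terms add up to 2, against errors \<open>\<pi>^2 / 9\<close>
  and \<open>9 / 25\<close>. The constant 3 for the tail is admissible since
  \<open>s \<ge> 9\<close> gives \<open>norm z ^ 2 \<le> s / 6\<close>. Heights up to
  \<open>sqrt (s / 8)\<close> are needed for the sign changes.\<close>

lemma Re_scaled_eis_pos_edge:
  assumes s: "odd s" "s \<ge> 9" and z: "Re z = - 1 / 2" "Im z \<ge> 11 / 20" "(Im z)\<^sup>2 \<le> real s / 8"
    and phase: "(z / (z + 1)) ^ s = 1"
  shows "Re (z ^ s * scaled_eis s z) > 0"
proof -
  have nz: "norm z ^ 2 = (Im z)\<^sup>2 + 1 / 4"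
    unfolding cmod_power2 using z by (simp add: power2_eq_square)
  have z0: "norm z > 0" using z by auto
  have "norm (z ^ s * lattice_line_sum s z - (1 + (z / (z + 1)) ^ s)) \<le> pi ^ 2 / (3 * 3)"
  proof (rule norm_lattice_line_sum_tail_le)
    fix n w assume w: "w \<in> {z + 2 + of_nat n, z - 1 - of_nat n}"
    define X where "X = (real n + 1) ^ 2 / norm z ^ 2"
    have "(1 + X) * norm z ^ 2 = norm z ^ 2 + (real n + 1) ^ 2"
      using z0 by (simp add: X_def distrib_right)
    hence "(1 + X) * norm z ^ 2 \<le> norm w ^ 2"
      using norm_shift_square_ge[OF _ _ w] z by simp
    moreover have "3 * (real n + 1) ^ 2 \<le> real s * X / 2"
    proof -
      have "norm z ^ 2 \<le> real s / 6"
        using z(3) s by (simp add: nz)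
      hence "3 * (real n + 1) ^ 2 * norm z ^ 2 \<le> 3 * (real n + 1) ^ 2 * (real s / 6)"
        by (intro mult_left_mono) auto
      thus ?thesis using z0 by (simp add: X_def field_simps)
    qed
    ultimately show "3 * (real n + 1) ^ 2 * norm z ^ s \<le> norm w ^ s"
      using power_ge_if_square_ge[of X "norm z" "norm w" s] s
        mult_right_mono[of "3 * (real n + 1) ^ 2" "1 + real s * X / 2" "norm z ^ s"]
      by (simp add: X_def)
  qed (use s z in auto)
  moreover have "norm (z ^ s * (scaled_eis s z - lattice_line_sum s z)) \<le> 9 / 25"
    using s z by (intro norm_scaled_eis_error_le) (simp_all add: nz)
  ultimately have "norm ((z ^ s * lattice_line_sum s z - 2) + z ^ s * (scaled_eis s z - lattice_line_sum s z))
      \<le> pi ^ 2 / (3 * 3) + 9 / 25"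
    unfolding phase by (intro norm_triangle_mono) auto
  hence "norm (2 - z ^ s * scaled_eis s z) < 2"
    using pi_square_le by (simp add: algebra_simps norm_minus_commute)
  moreover have "Re (2 - z ^ s * scaled_eis s z) \<le> norm (2 - z ^ s * scaled_eis s z)"
    by (rule complex_Re_le_cmod)
  ultimately show ?thesis by simp
qed

lemma norm_one_plus_power_minus_one_le:
  fixes w :: complex
  shows "norm ((1 + w) ^ n - 1) \<le> (1 + norm w) ^ n - 1"
proof (induction n)
  case (Suc n)
  have "(1 + w) ^ Suc n - 1 = (1 + w) * ((1 + w) ^ n - 1) + w"
    by (simp add: algebra_simps)
  also have "norm \<dots> \<le> (1 + norm w) * ((1 + norm w) ^ n - 1) + norm w"
    using Suc.IH norm_triangle_ineq[of 1 w]
    by (intro norm_triangle_mono) (auto simp: norm_mult intro!: mult_mono)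
  finally show ?case by (simp add: algebra_simps)
qed auto

text \<open>The power stays within \<open>exp (1/2) - 1 < 1\<close> of 1.\<close>

lemma Re_one_plus_power_pos:
  fixes w :: complex
  assumes "real n * norm w \<le> 1 / 2"
  shows "Re ((1 + w) ^ n) > 0"
proof -
  have "(1 + norm w) ^ n \<le> exp (norm w) ^ n"
    by (intro power_mono exp_ge_add_one_self) auto
  also have "\<dots> \<le> exp (1 / 2)"
    using assms by (simp flip: exp_of_nat_mult)
  also have "exp (1 / 2) < (2 :: real)"
  proof (rule power2_less_imp_less)
    have "exp (1 / 2) ^ 2 = (exp 1 :: real)"
      by (simp flip: exp_of_nat_mult)
    also have "\<dots> < 2 ^ 2" using exp_le by simp
    finally show "exp (1 / 2) ^ 2 < (2 :: real) ^ 2" .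
  qed auto
  finally have "norm ((1 + w) ^ n - 1) < 1"
    using norm_one_plus_power_minus_one_le[of w n] by linarith
  moreover have "- Re ((1 + w) ^ n - 1) \<le> norm ((1 + w) ^ n - 1)"
    using abs_Re_le_cmod[of "(1 + w) ^ n - 1"] by linarith
  ultimately show ?thesis by simp
qed

text \<open>
  Moving away from the edge \<open>Re z = - 1 / 2\<close> by \<open>u\<close>, the modulus of \<open>z / (z + 1)\<close> decays
  linearly in \<open>u\<close> while its argument changes only quadratically.
\<close>

lemma Re_ratio_power_nonneg:
  assumes y: "y \<ge> 1 / 2" and u: "0 \<le> u" "4 * real s * u ^ 2 \<le> 1"
    and phase: "(Complex (- 1 / 2) y / Complex (1 / 2) y) ^ s = 1"
  shows "Re ((Complex (u - 1 / 2) y / Complex (u + 1 / 2) y) ^ s) \<ge> 0"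
proof -
  define t where "t = y ^ 2 - 1 / 4"
  define D where "D = t ^ 2 + y ^ 2 + t * u ^ 2"
  define M where "M = (u + 1 / 2) ^ 2 + y ^ 2"
  define N where "N = 1 / 4 + y ^ 2"
  have t: "t \<ge> 0" using power_mono[OF y, of 2] by (simp add: t_def power2_eq_square)
  have y2: "y / 2 \<le> y ^ 2" using y by (simp add: power2_eq_square)
  have D: "D > 0" "y / 2 \<le> D"
  proof -
    have "y ^ 2 \<le> D" using t by (simp add: D_def)
    thus "D > 0" "y / 2 \<le> D" using y y2 by linarith+
  qed
  have MN: "M > 0" "N > 0"
    unfolding M_def N_def by (intro add_nonneg_pos; use y in simp)+
  have u0: "u + 1 / 2 \<noteq> 0" using u(1) by linarith
  \<comment> \<open>Up to a positive factor, \<open>1 + w\<close> is the quotient of the ratio at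
    \<open>u\<close> by the ratio at the edge; it has a purely imaginary \<open>w\<close> of size at
    most \<open>2 u^2\<close>, and the edge ratio drops out by \<open>phase\<close>.\<close>
  define w where "w = Complex 0 (- (y * u ^ 2 / D))"
  have "norm w = y * u ^ 2 / D"
    using y D by (simp add: w_def cmod_def)
  also have "\<dots> \<le> 2 * u ^ 2"
    using D mult_right_mono[OF D(2), of "u ^ 2"] by (simp add: field_simps)
  finally have "real s * norm w \<le> real s * (2 * u ^ 2)"
    by (intro mult_left_mono) auto
  hence w: "Re ((1 + w) ^ s) > 0"
    using u by (intro Re_one_plus_power_pos) auto
  have v: "Complex (u - 1 / 2) y / Complex (u + 1 / 2) y = Complex ((t + u ^ 2) / M) (y / M)"
    unfolding M_def t_def using u0 by (simp add: complex_eq_iff Re_divide Im_divide power2_eq_square field_simps)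
  have v0: "Complex (- 1 / 2) y / Complex (1 / 2) y = Complex (t / N) (y / N)"
    unfolding N_def t_def by (simp add: complex_eq_iff Re_divide Im_divide power2_eq_square field_simps)
  have tyN: "t ^ 2 + y ^ 2 = N ^ 2"
    by (simp add: t_def N_def power2_eq_square field_simps)
  have prod: "Complex ((t + u ^ 2) / M) (y / M) = of_real (D / (M * N)) * (1 + w) * Complex (t / N) (y / N)"
  proof -
    have "of_real (D / (M * N)) * (1 + w) = Complex (D / (M * N)) (- (y * u ^ 2 / (M * N)))"
      using D by (simp add: w_def complex_eq_iff)
    also have "\<dots> * Complex (t / N) (y / N) =
        Complex ((D * t + y ^ 2 * u ^ 2) / (M * N ^ 2)) ((D * y - y * u ^ 2 * t) / (M * N ^ 2))"
      using MN by (simp add: complex_eq_iff power2_eq_square field_simps)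
    also have "D * t + y ^ 2 * u ^ 2 = N ^ 2 * (t + u ^ 2)"
      unfolding tyN[symmetric] D_def by (simp add: power2_eq_square algebra_simps)
    also have "D * y - y * u ^ 2 * t = N ^ 2 * y"
      unfolding tyN[symmetric] D_def by (simp add: power2_eq_square algebra_simps)
    finally show ?thesis using MN by simp
  qed
  have "(Complex (u - 1 / 2) y / Complex (u + 1 / 2) y) ^ s = of_real ((D / (M * N)) ^ s) * (1 + w) ^ s"
    unfolding v prod power_mult_distrib phase[unfolded v0] by simp
  moreover have "0 \<le> (D / (M * N)) ^ s * Re ((1 + w) ^ s)"
    using w D MN by (intro mult_nonneg_nonneg zero_le_power divide_nonneg_nonneg) auto
  ultimately show ?thesis
    by (simp only: times_complex.sel Re_complex_of_real Im_complex_of_real mult_zero_left diff_zero)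
qed

text \<open>Of the main terms \<open>1 + (z / (z + 1))^s\<close>, the second has nonnegative real
  part near the edge and modulus at most \<open>2 / 5\<close> farther away, which leaves
  \<open>3 / 5\<close>. The errors are \<open>\<pi>^2 / 48\<close> and \<open>9 / 25\<close>, below
  \<open>3 / 5\<close> together.\<close>

lemma Re_scaled_eis_pos_left_half:
  assumes s: "odd s" "s \<ge> 9" and z: "- 1 / 2 \<le> Re z" "Re z \<le> 0" "Im z \<ge> 11 / 20" "(Im z)\<^sup>2 \<le> 3 / 4"
    and phase: "(Complex (- 1 / 2) (Im z) / Complex (1 / 2) (Im z)) ^ s = 1"
  shows "Re (z ^ s * scaled_eis s z) > 0"
proof -
  define u where "u = Re z + 1 / 2"
  have u: "0 \<le> u" "u \<le> 1 / 2" using z by (auto simp: u_def)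
  have zz: "z = Complex (u - 1 / 2) (Im z)" "z + 1 = Complex (u + 1 / 2) (Im z)"
    by (auto simp: complex_eq_iff u_def)
  have nz: "norm z ^ 2 \<le> (Im z)\<^sup>2 + 1 / 4"
  proof -
    have "\<bar>Re z\<bar> ^ 2 \<le> (1 / 2) ^ 2" using z by (intro power_mono) auto
    thus ?thesis unfolding cmod_power2 by (simp add: power2_eq_square)
  qed
  hence nz1: "norm z ^ 2 \<le> 1" using z by simp
  have z0: "z \<noteq> 0" using z by auto
  have tail: "norm (z ^ s * lattice_line_sum s z - (1 + (z / (z + 1)) ^ s)) \<le> pi ^ 2 / (3 * 16)"
  proof (rule norm_lattice_line_sum_tail_le)
    fix n w assume w: "w \<in> {z + 2 + of_nat n, z - 1 - of_nat n}"
    define m where "m = real n + 1"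
    have m: "m \<ge> 1" by (simp add: m_def)
    \<comment> \<open>The constant 16 comes from \<open>(2 m)^8 = 16^2 m^8\<close> and
      \<open>2 m \<le> 1 + m^2\<close>.\<close>
    have "16 ^ 2 * m ^ 4 \<le> (1 + m ^ 2) ^ 8"
    proof -
      have "(2 * m) ^ 8 \<le> (1 + m ^ 2) ^ 8"
      proof (intro power_mono)
        have "0 \<le> (m - 1) ^ 2" by simp
        thus "2 * m \<le> 1 + m ^ 2" by (simp add: power2_eq_square algebra_simps)
      qed (use m in auto)
      moreover have "16 ^ 2 * m ^ 4 \<le> 16 ^ 2 * m ^ 8"
        using m by (intro mult_left_mono power_increasing) auto
      ultimately show ?thesis by (simp add: power_mult_distrib)
    qed
    also have "\<dots> \<le> (1 + m ^ 2) ^ s"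
      using s by (intro power_increasing) auto
    finally have *: "(16 * m ^ 2) ^ 2 \<le> (1 + m ^ 2) ^ s"
      by (simp add: power_mult_distrib flip: power_mult)
    have "m ^ 2 * norm z ^ 2 \<le> m ^ 2 * 1"
      using nz1 by (intro mult_left_mono) auto
    hence **: "(1 + m ^ 2) * norm z ^ 2 \<le> norm w ^ 2"
      using norm_shift_square_ge[OF z(1,2) w] unfolding m_def distrib_right by linarith
    show "16 * (real n + 1) ^ 2 * norm z ^ s \<le> norm w ^ s"
    proof (rule power2_le_imp_le)
      have "(16 * (real n + 1) ^ 2 * norm z ^ s) ^ 2 = (16 * m ^ 2) ^ 2 * (norm z ^ 2) ^ s"
        by (simp add: m_def power_mult_distrib mult.commute flip: power_mult)
      also have "\<dots> \<le> (1 + m ^ 2) ^ s * (norm z ^ 2) ^ s"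
        using * by (intro mult_right_mono) auto
      also have "\<dots> = ((1 + m ^ 2) * norm z ^ 2) ^ s"
        by (simp add: power_mult_distrib)
      also have "\<dots> \<le> (norm w ^ 2) ^ s"
        using ** by (intro power_mono) auto
      finally show "(16 * (real n + 1) ^ 2 * norm z ^ s) ^ 2 \<le> (norm w ^ s) ^ 2"
        by (simp add: mult.commute flip: power_mult)
    qed auto
  qed (use s z in auto)
  have ratio: "Re ((z / (z + 1)) ^ s) \<ge> - (2 / 5)"
  proof (cases "4 * real s * u ^ 2 \<le> 1")
    case True
    have "Re ((Complex (u - 1 / 2) (Im z) / Complex (u + 1 / 2) (Im z)) ^ s) \<ge> 0"
      by (rule Re_ratio_power_nonneg) (use z u True phase in auto)
    thus ?thesis using zz by simp
  next
    case False
    \<comment> \<open>From \<open>4 s u^2 > 1\<close> and \<open>s \<ge> 9\<close>; then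
      \<open>1 + s u \<ge> 5 / 2\<close> bounds the growth of
      \<open>norm (z + 1) ^ s\<close>.\<close>
    have "(3 / 2) ^ 2 \<le> (real s * u) ^ 2"
    proof -
      have "9 * 1 \<le> real s * (4 * real s * u ^ 2)"
        using False s by (intro mult_mono) auto
      thus ?thesis by (simp add: power2_eq_square algebra_simps)
    qed
    hence su: "3 / 2 \<le> real s * u"
      using u by (intro power2_le_imp_le[of "3 / 2"]) auto
    have "(1 + 2 * u) * norm z ^ 2 \<le> norm (z + 1) ^ 2"
    proof -
      have "norm (z + 1) ^ 2 = norm z ^ 2 + 2 * u"
        unfolding cmod_power2 by (simp add: u_def power2_eq_square algebra_simps)
      moreover have "2 * u * norm z ^ 2 \<le> 2 * u * 1"
        using nz1 u by (intro mult_left_mono) auto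
      ultimately show ?thesis by (simp add: algebra_simps)
    qed
    hence "(1 + real s * (2 * u) / 2) * norm z ^ s \<le> norm (z + 1) ^ s"
      using u s by (intro power_ge_if_square_ge) auto
    moreover have "5 / 2 * norm z ^ s \<le> (1 + real s * (2 * u) / 2) * norm z ^ s"
      using su by (intro mult_right_mono) auto
    ultimately have "5 / 2 * norm z ^ s \<le> norm (z + 1) ^ s"
      by linarith
    moreover have "norm (z + 1) ^ s > 0"
      using z by (auto simp: complex_eq_iff)
    ultimately have "norm ((z / (z + 1)) ^ s) \<le> 2 / 5"
      by (simp add: norm_power norm_divide power_divide divide_simps)
    thus ?thesis
      using abs_Re_le_cmod[of "(z / (z + 1)) ^ s"] by linarith
  qed
  have err: "norm (z ^ s * (scaled_eis s z - lattice_line_sum s z)) \<le> 9 / 25"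
    using s z nz by (intro norm_scaled_eis_error_le) simp_all
  have "norm ((z ^ s * lattice_line_sum s z - (1 + (z / (z + 1)) ^ s)) + z ^ s * (scaled_eis s z - lattice_line_sum s z))
      \<le> pi ^ 2 / (3 * 16) + 9 / 25"
    by (intro norm_triangle_mono tail err)
  hence "norm (z ^ s * scaled_eis s z - (1 + (z / (z + 1)) ^ s)) < 3 / 5"
    using pi_square_le by (simp add: algebra_simps)
  moreover have "- Re (z ^ s * scaled_eis s z - (1 + (z / (z + 1)) ^ s)) \<le>
      norm (z ^ s * scaled_eis s z - (1 + (z / (z + 1)) ^ s))"
    using abs_Re_le_cmod[of "z ^ s * scaled_eis s z - (1 + (z / (z + 1)) ^ s)"] by linarith
  moreover have "Re (z ^ s * scaled_eis s z - (1 + (z / (z + 1)) ^ s)) =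
      Re (z ^ s * scaled_eis s z) - 1 - Re ((z / (z + 1)) ^ s)"
    by simp
  ultimately show ?thesis using ratio by linarith
qed

section \<open>Sign changes on the negative axis\<close>

text \<open>Here \<open>\<alpha>\<close> is the angle of the two points against the imaginary axis,
  and \<open>1 / (2 sin \<alpha>)\<close> their common modulus.\<close>

lemma edge_point_polar:
  assumes "0 < \<alpha>" "\<alpha> < pi / 2"
  shows "Complex (- 1 / 2) (1 / (2 * tan \<alpha>)) = of_real (1 / (2 * sin \<alpha>)) * (\<i> * cis \<alpha>)"
    and "Complex (1 / 2) (1 / (2 * tan \<alpha>)) = of_real (1 / (2 * sin \<alpha>)) * (\<i> * cis (- \<alpha>))"
  using sin_gt_zero2[OF assms] by (auto simp: complex_eq_iff tan_def)

lemma edge_angle_bounds: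
  assumes "0 < j" "2 * j < s"
  shows "0 < real j * pi / real s" "real j * pi / real s < pi / 2"
  using assms by (auto simp: field_simps)

text \<open>The quotient of the two points is \<open>cis (2 \<alpha>)\<close>, whose
  \<open>s\<close>-th power is \<open>cis (2 \<pi> j)\<close>. The factor \<open>(-1) ^ j\<close> in
  the second part produces the sign changes.\<close>

lemma edge_phase:
  assumes "0 < j" "2 * j < s"
  defines "\<alpha> \<equiv> real j * pi / real s"
  shows "(Complex (- 1 / 2) (1 / (2 * tan \<alpha>)) / Complex (1 / 2) (1 / (2 * tan \<alpha>))) ^ s = 1"
    and "Complex (- 1 / 2) (1 / (2 * tan \<alpha>)) ^ s = of_real ((1 / (2 * sin \<alpha>)) ^ s) * (\<i> ^ s * (-1) ^ j)"
proof -
  note \<alpha> = edge_angle_bounds[OF assms(1,2), folded \<alpha>_def]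
  have sn: "sin \<alpha> > 0" using sin_gt_zero2[OF \<alpha>] .
  have s\<alpha>: "real s * \<alpha> = real j * pi" using assms by (simp add: \<alpha>_def)
  have cj: "cis \<alpha> ^ s = (-1) ^ j"
  proof -
    have "cis \<alpha> ^ s = cis pi ^ j"
      by (simp only: Complex.DeMoivre s\<alpha>)
    thus ?thesis by simp
  qed
  have "Complex (- 1 / 2) (1 / (2 * tan \<alpha>)) / Complex (1 / 2) (1 / (2 * tan \<alpha>)) = cis \<alpha> / cis (- \<alpha>)"
    unfolding edge_point_polar[OF \<alpha>] using sn by simp
  also have "\<dots> = cis \<alpha> ^ 2"
    by (simp add: cis_divide power2_eq_square cis_mult)
  finally have ratio: "Complex (- 1 / 2) (1 / (2 * tan \<alpha>)) / Complex (1 / 2) (1 / (2 * tan \<alpha>)) = cis \<alpha> ^ 2" .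
  have "(cis \<alpha> ^ 2) ^ s = (cis \<alpha> ^ s) ^ 2"
    by (simp add: mult.commute flip: power_mult)
  thus "(Complex (- 1 / 2) (1 / (2 * tan \<alpha>)) / Complex (1 / 2) (1 / (2 * tan \<alpha>))) ^ s = 1"
    unfolding ratio cj by (simp flip: power_mult)
  show "Complex (- 1 / 2) (1 / (2 * tan \<alpha>)) ^ s = of_real ((1 / (2 * sin \<alpha>)) ^ s) * (\<i> ^ s * (-1) ^ j)"
    unfolding edge_point_polar[OF \<alpha>] power_mult_distrib cj of_real_power ..
qed

text \<open>The argument is negated, so that the zeros of interest become positive.\<close>

definition eis_deriv_real :: "nat \<Rightarrow> real \<Rightarrow> real" where
  "eis_deriv_real k x = (\<Sum>n. real (n * divisor_sigma (k - 1) n) * (- x) ^ n)"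

lemma eis_deriv_series_of_real:
  assumes "k \<ge> 4" "\<bar>x\<bar> < 1"
  shows "eis_deriv_series k (- of_real x) = of_real (eis_deriv_real k x)"
proof -
  have "summable (\<lambda>n. real (n * divisor_sigma (k - 1) n) * (- x) ^ n)"
    using summable_eis_deriv_series[OF assms(1), of "- x"] assms(2) by (simp add: summable_norm_cancel)
  thus ?thesis
    unfolding eis_deriv_series_def eis_deriv_real_def by (simp add: suminf_of_real)
qed

text \<open>The positive quantity \<open>z^s \<Phi>(z)\<close> is real at the edge point. The
  factors \<open>i^s\<close> from \<open>z^s\<close> and from \<open>(2 \<pi> i)^s\<close> multiply
  to -1, which cancels the sign in \<open>scaled_eis\<close> and leaves
  \<open>(-1) ^ j\<close>.\<close>

lemma eis_deriv_real_sign_edge: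
  assumes k: "even k" "k \<ge> 8" and j: "0 < j" "2 * j < Suc k"
  defines "y \<equiv> 1 / (2 * tan (real j * pi / real (Suc k)))"
  assumes y: "y \<ge> 11 / 20" "y\<^sup>2 \<le> real (Suc k) / 8"
  shows "(-1) ^ j * eis_deriv_real k (exp (- 2 * pi * y)) > 0"
proof -
  define s where "s = Suc k"
  define z where "z = Complex (- 1 / 2) y"
  define r where "r = 1 / (2 * sin (real j * pi / real s))"
  have s: "odd s" "s \<ge> 9" using k by (auto simp: s_def)
  have z1: "z + 1 = Complex (1 / 2) y" by (simp add: z_def complex_eq_iff)
  have r: "r > 0"
    unfolding r_def s_def by (intro divide_pos_pos mult_pos_pos sin_gt_zero2 edge_angle_bounds j) auto
  have "(z / (z + 1)) ^ s = 1"
    using edge_phase(1)[OF j] unfolding z1 by (simp add: z_def y_def s_def)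
  hence pos: "Re (z ^ s * scaled_eis s z) > 0"
    using s y by (intro Re_scaled_eis_pos_edge) (auto simp: z_def s_def)
  have zs: "z ^ s = of_real (r ^ s) * (\<i> ^ s * (-1) ^ j)"
    using edge_phase(2)[OF j] by (simp add: z_def y_def s_def r_def)
  have "exp (2 * of_real pi * \<i> * z) = exp (of_real (- 2 * pi * y) + - (of_real pi * \<i>))"
    by (intro arg_cong[of _ _ exp]) (simp add: z_def complex_eq_iff)
  also have "\<dots> = - of_real (exp (- 2 * pi * y))"
    unfolding exp_add exp_minus[of "of_real pi * \<i>"] exp_pi_i exp_of_real by simp
  finally have "scaled_eis s z = - ((2 * of_real pi * \<i>) ^ s) / fact k * of_real (eis_deriv_real k (exp (- 2 * pi * y)))"
    using eis_deriv_series_of_real[of k "exp (- 2 * pi * y)"] k y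
    by (simp add: scaled_eis_def s_def)
  also have "(2 * of_real pi * \<i>) ^ s = of_real ((2 * pi) ^ s) * \<i> ^ s"
    by (simp add: power_mult_distrib)
  finally have "z ^ s * scaled_eis s z =
     of_real (r ^ s * (2 * pi) ^ s / fact k) * (- (\<i> ^ s * \<i> ^ s)) * of_real ((-1) ^ j * eis_deriv_real k (exp (- 2 * pi * y)))"
    unfolding zs by simp
  also have "\<i> ^ s * \<i> ^ s = -1"
    using s(1) by (simp flip: power_mult_distrib)
  finally have "z ^ s * scaled_eis s z =
      of_real ((r ^ s * (2 * pi) ^ s / fact k) * ((-1) ^ j * eis_deriv_real k (exp (- 2 * pi * y))))"
    by (simp only: of_real_mult minus_minus mult_1_right)
  hence "Re (z ^ s * scaled_eis s z) = (r ^ s * (2 * pi) ^ s / fact k) * ((-1) ^ j * eis_deriv_real k (exp (- 2 * pi * y)))"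
    by (simp only: Re_complex_of_real)
  with pos have "0 < (r ^ s * (2 * pi) ^ s / fact k) * ((-1) ^ j * eis_deriv_real k (exp (- 2 * pi * y)))"
    by simp
  moreover have "r ^ s * (2 * pi) ^ s / fact k > 0"
    using r by simp
  ultimately show ?thesis
    using zero_less_mult_pos by blast
qed

lemma ln_le_half_diff_inverse:
  assumes "1 \<le> (t::real)"
  shows "ln t \<le> (t - 1 / t) / 2"
proof -
  have "(1 - 1 / 1) / 2 - ln 1 \<le> (t - 1 / t) / 2 - ln t"
  proof (rule DERIV_nonneg_imp_nondecreasing[OF assms])
    fix x :: real assume x: "1 \<le> x" "x \<le> t"
    have "((\<lambda>t. (t - 1 / t) / 2 - ln t) has_real_derivative (1 - 1 / x) ^ 2 / 2) (at x)"
      using x by (auto intro!: derivative_eq_intros simp: power2_eq_square field_simps)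
    thus "\<exists>D. ((\<lambda>t. (t - 1 / t) / 2 - ln t) has_real_derivative D) (at x) \<and> 0 \<le> D"
      by (intro exI conjI) auto
  qed
  thus ?thesis by simp
qed

lemma ln_le_quadratic:
  assumes "0 < (t::real)" "t \<le> 1"
  shows "ln t \<le> t - 1 - (1 - t) ^ 2 / 2"
proof -
  have "1 - 1 - (1 - 1) ^ 2 / 2 - ln 1 \<le> t - 1 - (1 - t) ^ 2 / 2 - ln t"
  proof (rule DERIV_nonpos_imp_nonincreasing[OF assms(2)])
    fix x :: real assume x: "t \<le> x" "x \<le> 1"
    have "((\<lambda>t. t - 1 - (1 - t) ^ 2 / 2 - ln t) has_real_derivative - ((1 - x) ^ 2 / x)) (at x)"
      using x assms by (auto intro!: derivative_eq_intros simp: power2_eq_square field_simps)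
    moreover have "- ((1 - x) ^ 2 / x) \<le> 0" using x assms by simp
    ultimately show "\<exists>D. ((\<lambda>t. t - 1 - (1 - t) ^ 2 / 2 - ln t) has_real_derivative D) (at x) \<and> D \<le> 0"
      by blast
  qed
  thus ?thesis by simp
qed

text \<open>With \<open>t = n / j\<close> the left side is the term \<open>n^k x^n\<close> relative
  to its peak at \<open>j\<close>. The decay is Gaussian for \<open>t \<le> 1\<close> but only
  exponential for large \<open>t\<close>, hence \<open>max 1 t\<close>.\<close>

lemma times_exp_one_minus_power_le:
  fixes t :: real
  assumes "t > 0"
  shows "(t * exp (1 - t)) ^ k \<le> exp (- (real k * (t - 1) ^ 2 / (2 * max 1 t)))"
proof -
  have "ln t + 1 - t \<le> - ((t - 1) ^ 2 / (2 * max 1 t))"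
  proof (cases "t \<ge> 1")
    case True
    have "(t - 1 / t) / 2 + 1 - t = - ((t - 1) ^ 2 / (2 * t))"
      using True by (simp add: power2_eq_square field_simps)
    moreover have "max 1 t = t" using True by simp
    ultimately show ?thesis using ln_le_half_diff_inverse[OF True] by linarith
  next
    case False
    thus ?thesis using ln_le_quadratic[of t] assms by (simp add: max_def power2_commute)
  qed
  hence "real k * (ln t + 1 - t) \<le> real k * - ((t - 1) ^ 2 / (2 * max 1 t))"
    by (intro mult_left_mono) auto
  moreover have "(t * exp (1 - t)) ^ k = exp (real k * (ln t + 1 - t))"
    unfolding exp_of_nat_mult using assms by (simp add: exp_add exp_diff)
  ultimately show ?thesis by simp
qed

text \<open>
  At \<open>x = exp (- k / j)\<close> the terms \<open>n ^ k * x ^ n\<close> have their maximum at \<open>n = j\<close>, and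
  \<open>4 * j\<^sup>2 \<le> k\<close> makes this peak sharp enough for one term to dominate the series.
\<close>

lemma eis_deriv_real_sign_peak:
  assumes k: "k \<ge> 4" and j: "0 < j" "4 * j\<^sup>2 \<le> k"
  shows "(-1) ^ j * eis_deriv_real k (exp (- (real k / real j))) > 0"
proof -
  define x where "x = exp (- (real k / real j))"
  define a where "a = (\<lambda>n. real (n * divisor_sigma (k - 1) n))"
  define M where "M = real j ^ k * x ^ j"
  have x: "0 < x" "x < 1" and M: "M > 0"
    using k j by (auto simp: x_def M_def)
  have le: "a n * x ^ n / M \<le> 5 / 4 * exp (- (real k * (real n / real j - 1) ^ 2 / (2 * max 1 (real n / real j))))"
    if n: "n > 0" for n
  proof -
    define t where "t = real n / real j"
    have t: "t > 0" using n j by (simp add: t_def)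
    have "a n * x ^ n / M \<le> 5 / 4 * real n ^ k * x ^ n / M"
      unfolding a_def using nat_times_divisor_sigma_le[OF k, of n] x M
      by (intro divide_right_mono mult_right_mono) auto
    also have "\<dots> = 5 / 4 * (t ^ k * (x ^ n / x ^ j))"
      using j x by (simp add: M_def t_def power_divide)
    also have "x ^ n / x ^ j = exp (1 - t) ^ k"
    proof -
      have "x ^ n / x ^ j = exp (real n * - (real k / real j) - real j * - (real k / real j))"
        unfolding exp_diff exp_of_nat_mult x_def ..
      also have "real n * - (real k / real j) - real j * - (real k / real j) = real k * (1 - t)"
        using j by (simp add: t_def field_simps)
      finally show ?thesis by (simp add: exp_of_nat_mult)
    qed
    also have "t ^ k * exp (1 - t) ^ k = (t * exp (1 - t)) ^ k"
      by (simp add: power_mult_distrib)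
    also have "\<dots> \<le> exp (- (real k * (t - 1) ^ 2 / (2 * max 1 t)))"
      by (rule times_exp_one_minus_power_le[OF t])
    finally show ?thesis by (simp add: t_def)
  qed
  have kj: "4 * (real j * real j) \<le> real k"
  proof -
    have "real (4 * j\<^sup>2) \<le> real k" using j(2) by (simp only: of_nat_le_iff)
    thus ?thesis by (simp add: power2_eq_square)
  qed
  define e where "e = exp (-1 :: real)"
  have e: "0 < e" "e < 1" by (auto simp: e_def)
  \<comment> \<open>At distance \<open>m = n + 1\<close> above the peak the exponent is at least
    \<open>2 j m^2 / (j + m) \<ge> m\<close>.\<close>
  have hi: "a (n + Suc j) * x ^ (n + Suc j) / M \<le> 5 / 4 * (e * e ^ n)" for n
  proof -
    define m where "m = real n + 1"
    have m: "m \<ge> 1" by (simp add: m_def)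
    have nj: "real (n + Suc j) / real j = (real j + m) / real j" by (simp add: m_def add_ac)
    have mx: "max 1 ((real j + m) / real j) = (real j + m) / real j"
      using m j by (auto simp: max_def field_simps)
    have d: "(real j + m) / real j - 1 = m / real j" using j by (simp add: field_simps)
    have "m * (real j + m) \<le> 2 * real j * m * m"
    proof -
      have "0 \<le> real j * (m - 1) + m * (real j - 1)"
        using m j by (intro add_nonneg_nonneg mult_nonneg_nonneg) auto
      hence "real j + m \<le> 2 * real j * m" by (simp add: algebra_simps)
      from mult_left_mono[OF this, of m] show ?thesis using m by (simp add: mult_ac)
    qed
    moreover have "4 * (real j * real j) * (m * m) \<le> real k * (m * m)"
      using kj by (intro mult_right_mono) auto
    ultimately have "m * (2 * (real j * (real j + m))) \<le> real k * (m * m)"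
      using j mult_left_mono[of "m * (real j + m)" "2 * real j * m * m" "2 * real j"] by (simp add: mult_ac)
    hence "m \<le> real k * (m * m) / (2 * (real j * (real j + m)))"
      using m j by (subst pos_le_divide_eq) (auto intro!: mult_pos_pos add_pos_nonneg)
    also have "\<dots> = real k * (m / real j) ^ 2 / (2 * ((real j + m) / real j))"
      using j m by (simp add: power2_eq_square field_simps)
    finally have "exp (- (real k * (m / real j) ^ 2 / (2 * ((real j + m) / real j)))) \<le> exp (- m)"
      by simp
    also have "exp (- m) = e * e ^ n"
      by (simp add: e_def m_def flip: exp_of_nat_mult exp_add)
    finally show ?thesis
      using le[of "n + Suc j"] unfolding nj mx d by simp
  qed
  \<comment> \<open>At distance \<open>m\<close> below the peak the exponent is at least
    \<open>2 m^2 \<ge> 2 m\<close>; the term \<open>n = 0\<close> vanishes.\<close>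
  have lo: "a n * x ^ n / M \<le> 5 / 4 * (e\<^sup>2) ^ (j - n)" if n: "n < j" for n
  proof (cases "n = 0")
    case False
    define m where "m = real j - real n"
    have m: "m \<ge> 1" using n by (simp add: m_def)
    have mx: "max 1 (real n / real j) = 1" using n by (auto simp: max_def field_simps)
    have d: "(real n / real j - 1) ^ 2 = m ^ 2 / real j ^ 2"
      using j by (simp add: m_def power2_eq_square field_simps)
    have "4 * (real j * real j) * (m * 1) \<le> real k * (m * m)"
      using kj m by (intro mult_mono) auto
    hence "2 * m \<le> real k * (m ^ 2 / real j ^ 2) / (2 * 1)"
      using j by (simp add: power2_eq_square field_simps)
    hence "exp (- (real k * (m ^ 2 / real j ^ 2) / (2 * 1))) \<le> exp (- (2 * m))"
      by simp
    also have "\<dots> = (e\<^sup>2) ^ (j - n)"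
      using n by (simp add: e_def m_def of_nat_diff flip: exp_of_nat_mult)
    finally show ?thesis
      using le[of n] False unfolding mx d by simp
  qed (use e in \<open>simp add: a_def\<close>)
  have sm: "summable (\<lambda>n. a n * x ^ n)"
    using summable_eis_deriv_series[OF k, of x] x by (simp add: a_def)
  define f where "f = (\<lambda>n. (-1) ^ j * (a n * (- x) ^ n) / M)"
  have af: "\<bar>f n\<bar> = a n * x ^ n / M" for n
    using x M by (simp add: f_def abs_mult power_abs a_def)
  have smf: "summable f"
    by (rule summable_comparison_test'[OF summable_divide[OF sm, of M], of 0]) (simp add: af)
  have "(-1) ^ j * eis_deriv_real k x / M = (\<Sum>n. f n)"
  proof -
    have "summable (\<lambda>n. a n * (- x) ^ n)"
      by (rule summable_comparison_test'[OF sm, of 0]) (use x in \<open>simp add: abs_mult power_abs a_def\<close>)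
    thus ?thesis
      unfolding f_def eis_deriv_real_def a_def
      by (simp only: suminf_mult suminf_divide summable_mult)
  qed
  also have "\<dots> = (\<Sum>n. f (n + Suc j)) + (\<Sum>n<j. f n) + f j"
    using suminf_split_initial_segment[OF smf, of "Suc j"] by simp
  finally have eq: "(-1) ^ j * eis_deriv_real k x / M = (\<Sum>n. f (n + Suc j)) + (\<Sum>n<j. f n) + f j" .
  have "f j \<ge> 1"
  proof -
    have "j ^ k \<le> j * divisor_sigma (k - 1) j"
      using nat_times_divisor_sigma_ge[of k j] k j by simp
    hence "real j ^ k \<le> a j"
      unfolding a_def by (metis of_nat_le_iff of_nat_power)
    hence "M \<le> a j * x ^ j" using x by (simp add: M_def)
    moreover have "f j = a j * x ^ j / M"
    proof -
      have "(-1) ^ j * (- x) ^ j = x ^ j"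
        by (simp flip: power_mult_distrib)
      thus ?thesis by (simp only: f_def mult.left_commute[of "(-1) ^ j"])
    qed
    ultimately show ?thesis using M by simp
  qed
  moreover have "\<bar>\<Sum>n. f (n + Suc j)\<bar> \<le> 5 / 4 * (e / (1 - e))"
  proof -
    have sg: "(\<lambda>n. 5 / 4 * (e * e ^ n)) sums (5 / 4 * (e * (1 / (1 - e))))"
      using e by (intro sums_mult geometric_sums) auto
    have "norm (\<Sum>n. f (n + Suc j)) \<le> (\<Sum>n. 5 / 4 * (e * e ^ n))"
      using hi sg by (intro norm_suminf_le) (auto simp: af sums_iff)
    thus ?thesis using sg by (simp add: sums_iff)
  qed
  moreover have "\<bar>\<Sum>n<j. f n\<bar> \<le> 5 / 4 * (e\<^sup>2 / (1 - e\<^sup>2))"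
  proof -
    have e2: "0 < e\<^sup>2" "e\<^sup>2 < 1" using e by (auto simp: power_less_one_iff)
    have sg: "(\<lambda>n. (e\<^sup>2) * (e\<^sup>2) ^ n) sums ((e\<^sup>2) * (1 / (1 - e\<^sup>2)))"
      using e2 by (intro sums_mult geometric_sums) auto
    have "\<bar>\<Sum>n<j. f n\<bar> \<le> (\<Sum>n<j. 5 / 4 * (e\<^sup>2) ^ (j - n))"
      by (intro order.trans[OF sum_abs] sum_mono) (simp only: af lo lessThan_iff)
    also have "\<dots> = (\<Sum>n<j. 5 / 4 * ((e\<^sup>2) * (e\<^sup>2) ^ (j - Suc n)))"
      by (intro sum.cong refl) (metis lessThan_iff Suc_diff_Suc power_Suc)
    also have "\<dots> = (\<Sum>n<j. 5 / 4 * ((e\<^sup>2) * (e\<^sup>2) ^ n))"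
      by (rule sum.nat_diff_reindex)
    also have "\<dots> = 5 / 4 * (\<Sum>n<j. (e\<^sup>2) * (e\<^sup>2) ^ n)"
      by (simp only: sum_distrib_left)
    also have "\<dots> \<le> 5 / 4 * (\<Sum>n. (e\<^sup>2) * (e\<^sup>2) ^ n)"
      using sg e2 by (intro mult_left_mono sum_le_suminf) (auto simp: sums_iff)
    finally show ?thesis
      unfolding sums_unique[OF sg, symmetric] by (simp only: times_divide_eq_right mult_1_right)
  qed
  moreover have "5 / 4 * (e / (1 - e)) + 5 / 4 * (e\<^sup>2 / (1 - e\<^sup>2)) < 1"
  proof -
    have "exp (1::real) \<ge> 2.7"
    proof -
      have "- inverse (2 ^ 32) \<le> exp 1 - 5837465777 / (2147483648 :: real)"
        using e_approx_32 unfolding abs_le_iff by linarith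
      thus ?thesis by simp
    qed
    hence e': "e \<le> 10 / 27"
      by (simp add: e_def exp_minus field_simps)
    have "e / (1 - e) \<le> (10 / 27) / (1 - 10 / 27)"
      using e e' by (intro frac_le) auto
    moreover have "e\<^sup>2 \<le> (10 / 27)\<^sup>2"
      using e e' by (intro power_mono) auto
    hence "e\<^sup>2 / (1 - e\<^sup>2) \<le> (10 / 27)\<^sup>2 / (1 - (10 / 27)\<^sup>2)"
      using e by (intro frac_le) (auto simp: power2_eq_square)
    moreover have "5 / 4 * ((10 / 27) / (1 - 10 / 27)) + 5 / 4 * ((10 / 27)\<^sup>2 / (1 - (10 / 27)\<^sup>2)) < (1 :: real)"
      by (simp add: power2_eq_square)
    ultimately show ?thesis by linarith
  qed
  ultimately have "(-1) ^ j * eis_deriv_real k x / M > 0"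
    unfolding eq by linarith
  hence "0 < ((-1) ^ j * eis_deriv_real k x / M) * M"
    using M by (rule mult_pos_pos)
  also have "\<dots> = (-1) ^ j * eis_deriv_real k x"
    using M by simp
  finally show ?thesis unfolding x_def .
qed

section \<open>Counting zeros\<close>

text \<open>The hypotheses put the angle between \<open>\<pi> / 6\<close> and
  \<open>3 \<pi> / 13 = \<pi> / 4 - \<pi> / 52\<close>; the first bound gives
  \<open>sqrt 3 / 2\<close>, the second \<open>11 / 20\<close>.\<close>

lemma tan_edge_bounds:
  assumes "0 < j" "s \<le> 6 * j" "13 * j \<le> 3 * s"
  defines "y \<equiv> 1 / (2 * tan (real j * pi / real s))"
  shows "11 / 20 \<le> y" "y\<^sup>2 \<le> 3 / 4"
proof -
  define \<alpha> where "\<alpha> = real j * pi / real s"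
  have y: "y = 1 / (2 * tan \<alpha>)" by (simp add: y_def \<alpha>_def)
  have s: "s > 0" using assms by linarith
  have "real s \<le> real (6 * j)" "real (13 * j) \<le> real (3 * s)"
    using assms(2,3) by (simp_all only: of_nat_le_iff)
  hence \<alpha>: "pi / 6 \<le> \<alpha>" "\<alpha> \<le> 3 * pi / 13"
    using s by (auto simp: \<alpha>_def field_simps)
  have t: "tan \<alpha> > 0" using \<alpha> pi_gt_zero by (intro tan_gt_zero) linarith+
  have "tan (pi / 6) \<le> tan \<alpha>"
    using \<alpha> pi_gt_zero by (intro tan_mono_le) linarith+
  hence t6: "1 / sqrt 3 \<le> tan \<alpha>"
    by (simp add: tan_30)
  show "y\<^sup>2 \<le> 3 / 4"
  proof -
    have "(1 / sqrt 3)\<^sup>2 \<le> (tan \<alpha>)\<^sup>2"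
      using t6 by (intro power_mono) auto
    hence "1 / 3 \<le> (tan \<alpha>)\<^sup>2" by (simp add: power_divide)
    thus ?thesis
      unfolding y using t by (simp add: power_divide power_mult_distrib field_simps)
  qed
  define d where "d = tan (pi / 52)"
  have d: "d \<ge> 0.06"
  proof -
    have "pi / 52 \<le> \<bar>tan (pi / 52)\<bar>"
      using abs_tan_ge[of "pi / 52"] by simp
    moreover have "tan (pi / 52) > 0" by (intro tan_gt_zero) auto
    moreover have "pi / 52 \<ge> 0.06" using pi_approx by simp
    ultimately show ?thesis unfolding d_def by linarith
  qed
  have "tan \<alpha> \<le> tan (pi / 4 - pi / 52)"
    using \<alpha> pi_gt_zero by (intro tan_mono_le) linarith+
  also have "\<dots> = (1 - d) / (1 + d)"
  proof -
    have "cos (pi / 4) \<noteq> 0" "cos (pi / 52) \<noteq> 0" "cos (pi / 4 - pi / 52) \<noteq> 0"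
      using pi_gt_zero by (intro order.strict_implies_not_eq[symmetric] cos_gt_zero_pi; linarith)+
    thus ?thesis by (subst tan_diff) (auto simp: d_def tan_45)
  qed
  also have "\<dots> \<le> 10 / 11"
    using d by (simp add: field_simps)
  finally show "11 / 20 \<le> y"
    unfolding y using t by (simp add: field_simps)
qed

lemma eis_deriv_series_0: "eis_deriv_series k 0 = 0"
proof -
  have "of_nat (n * divisor_sigma (k - 1) n) * 0 ^ n = (0 :: complex)" for n
    by (cases n) auto
  thus ?thesis unfolding eis_deriv_series_def by simp
qed

lemma eis_deriv_series_cnj:
  assumes "k \<ge> 4" "norm q < 1"
  shows "eis_deriv_series k (cnj q) = cnj (eis_deriv_series k q)"
proof -
  have "(\<lambda>n. of_nat (n * divisor_sigma (k - 1) n) * q ^ n) sums eis_deriv_series k q"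
    unfolding eis_deriv_series_def
    using summable_norm_cancel[OF summable_eis_deriv_series[OF assms]] by (rule summable_sums)
  hence "(\<lambda>n. cnj (of_nat (n * divisor_sigma (k - 1) n) * q ^ n)) sums cnj (eis_deriv_series k q)"
    by (simp only: sums_cnj)
  thus ?thesis
    unfolding eis_deriv_series_def by (simp add: sums_iff)
qed

text \<open>The coefficients of \<open>P\<close> are real, and for odd \<open>s\<close> the signs
  from \<open>(- cnj z)^s\<close> and from \<open>(2 \<pi> i)^s\<close> cancel. This carries
  positivity over to the right half of the segment.\<close>

lemma scaled_eis_reflect:
  assumes "odd s" "s \<ge> 5" "Im z > 0"
  shows "(- cnj z) ^ s * scaled_eis s (- cnj z) = cnj (z ^ s * scaled_eis s z)"
proof -
  let ?q = "exp (2 * of_real pi * \<i> * z)"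
  have "exp (2 * of_real pi * \<i> * - cnj z) = cnj ?q"
    by (simp add: exp_cnj)
  moreover have "eis_deriv_series (s - 1) (cnj ?q) = cnj (eis_deriv_series (s - 1) ?q)"
    using assms by (intro eis_deriv_series_cnj) auto
  moreover have "cnj ((2 * of_real pi * \<i>) ^ s) = - ((2 * of_real pi * \<i>) ^ s)"
    using power_minus_odd[OF assms(1), of "2 * of_real pi * \<i>"] by simp
  moreover have "(- cnj z) ^ s = - (cnj z ^ s)"
    using assms(1) by simp
  ultimately show ?thesis
    by (simp add: scaled_eis_def)
qed

lemma Re_scaled_eis_pos:
  assumes "odd s" "s \<ge> 9" "0 < j" "s \<le> 6 * j" "13 * j \<le> 3 * s" "\<bar>Re z\<bar> \<le> 1 / 2"
    and "Im z = 1 / (2 * tan (real j * pi / real s))"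
  shows "Re (z ^ s * scaled_eis s z) > 0"
proof -
  note y = tan_edge_bounds[OF assms(3-5), folded assms(7)]
  have phase: "(Complex (- 1 / 2) (Im z) / Complex (1 / 2) (Im z)) ^ s = 1"
    unfolding assms(7) using assms by (intro edge_phase) auto
  show ?thesis
  proof (cases "Re z \<le> 0")
    case True
    thus ?thesis
      using assms y phase by (intro Re_scaled_eis_pos_left_half) auto
  next
    case False
    have "Re ((- cnj z) ^ s * scaled_eis s (- cnj z)) > 0"
      using False assms y phase by (intro Re_scaled_eis_pos_left_half) auto
    moreover have "Im z > 0" using y by simp
    ultimately have "Re (cnj (z ^ s * scaled_eis s z)) > 0"
      using scaled_eis_reflect[OF assms(1) _ \<open>Im z > 0\<close>] assms(2) by (simp only:)
    thus ?thesis by (simp only: cnj.sel)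
  qed
qed

text \<open>The arguments \<open>\<pi> / 2 + \<alpha>\<close> and
  \<open>\<pi> / 2 - \<alpha>\<close> are both principal; \<open>s\<close> times the difference is
  \<open>2 \<pi> i j\<close>, the source of the zero count.\<close>

lemma Ln_edge_points:
  assumes "0 < \<alpha>" "\<alpha> < pi / 2"
  shows "Ln (Complex (- 1 / 2) (1 / (2 * tan \<alpha>))) - Ln (Complex (1 / 2) (1 / (2 * tan \<alpha>))) = 2 * \<i> * of_real \<alpha>"
proof -
  define r where "r = 1 / (2 * sin \<alpha>)"
  have r: "r > 0" using sin_gt_zero2[OF assms] by (simp add: r_def)
  have *: "of_real r * (\<i> * cis \<beta>) = exp (of_real (ln r) + \<i> * of_real (pi / 2 + \<beta>))" for \<beta>
  proof -
    have "exp (of_real (ln r) + \<i> * of_real (pi / 2 + \<beta>)) = of_real (exp (ln r)) * cis (pi / 2 + \<beta>)"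
      by (simp only: exp_add exp_of_real cis_conv_exp)
    also have "cis (pi / 2 + \<beta>) = \<i> * cis \<beta>"
      by (simp flip: cis_mult)
    finally show ?thesis using r by simp
  qed
  have "Ln (of_real r * (\<i> * cis \<beta>)) = of_real (ln r) + \<i> * of_real (pi / 2 + \<beta>)"
    if "\<bar>\<beta>\<bar> < pi / 2" for \<beta>
    unfolding * using that by (intro Ln_exp) auto
  note this[of \<alpha>] this[of "- \<alpha>"]
  thus ?thesis
    unfolding edge_point_polar[OF assms] r_def[symmetric] using assms by (simp add: algebra_simps)
qed

text \<open>The circle is the image of the segment, on which \<open>z^s \<Phi>(z)\<close> stays in
  the right half-plane and has a principal logarithm. At both ends this logarithm agrees, so only
  the change of \<open>s Ln z\<close> contributes.\<close>

lemma contour_integral_log_deriv_eis: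
  assumes k: "even k" "k \<ge> 8" and j: "0 < j" "Suc k \<le> 6 * j" "13 * j \<le> 3 * Suc k"
  defines "Q \<equiv> \<lambda>w. eis_deriv_series k (- w)"
    and "R \<equiv> exp (- 2 * pi * (1 / (2 * tan (real j * pi / real (Suc k)))))"
  shows "contour_integral (circlepath 0 R) (\<lambda>w. deriv Q w / Q w) = 2 * of_real pi * \<i> * of_nat j"
    and "\<And>w. norm w = R \<Longrightarrow> Q w \<noteq> 0"
proof -
  define s where "s = Suc k"
  have s: "odd s" "s \<ge> 9" using k by (auto simp: s_def)
  note j' = j[folded s_def]
  define \<alpha> where "\<alpha> = real j * pi / real s"
  define y where "y = 1 / (2 * tan \<alpha>)"
  have R: "R = exp (- 2 * pi * y)" by (simp add: R_def y_def \<alpha>_def s_def)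
  have y: "y > 0" using tan_edge_bounds(1)[OF j', folded \<alpha>_def, folded y_def] by simp
  have R1: "R < 1" "R > 0" using y by (auto simp: R)
  have \<alpha>: "0 < \<alpha>" "\<alpha> < pi / 2"
    unfolding \<alpha>_def using j' by (intro edge_angle_bounds; linarith)+
  define \<kappa> where "\<kappa> = - ((2 * of_real pi * \<i>) ^ s) / (fact k :: complex)"
  \<comment> \<open>The sign matches the one in \<open>Q\<close> and sends the left end of the
    segment to \<open>R\<close>, where \<open>circlepath 0 R\<close> starts.\<close>
  define g where "g = (\<lambda>\<zeta>. - exp (2 * of_real pi * \<i> * \<zeta>))"
  have se: "scaled_eis s \<zeta> = \<kappa> * Q (g \<zeta>)" for \<zeta>
    by (simp add: scaled_eis_def \<kappa>_def s_def Q_def g_def)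
  have holQ: "Q holomorphic_on ball 0 1"
    unfolding Q_def
    by (rule holomorphic_on_compose_gen[of uminus, unfolded o_def, OF _ holomorphic_eis_deriv_series])
      (use k in \<open>auto intro!: holomorphic_intros\<close>)
  define L where "L = {Complex x y |x. \<bar>x\<bar> \<le> 1 / 2}"
  have pos: "Re (\<zeta> ^ s * (\<kappa> * Q (g \<zeta>))) > 0" if "\<zeta> \<in> L" for \<zeta>
    using that Re_scaled_eis_pos[OF s j', of \<zeta>] by (auto simp: L_def se y_def \<alpha>_def)
  have gL: "norm (g \<zeta>) < 1" if "\<zeta> \<in> L" for \<zeta>
    using that y by (auto simp: L_def g_def)
  have QL: "Q (g \<zeta>) \<noteq> 0" if "\<zeta> \<in> L" for \<zeta>
    using pos[OF that] by auto
  show "Q w \<noteq> 0" if w: "norm w = R" for w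
  proof -
    define x where "x = Arg (- w) / (2 * pi)"
    have "\<bar>x\<bar> \<le> 1 / 2"
      using Arg_bounded[of "- w"] pi_gt_zero by (auto simp: x_def abs_le_iff field_simps)
    moreover have "g (Complex x y) = w"
    proof -
      have "- w = of_real R * exp (\<i> * of_real (Arg (- w)))"
        using Arg_eq[of "- w"] w R1 by auto
      also have "\<dots> = exp (2 * of_real pi * \<i> * Complex x y)"
        unfolding R exp_of_real[symmetric] exp_add[symmetric]
        by (intro arg_cong[of _ _ exp]) (simp add: complex_eq_iff x_def)
      finally have e: "- w = exp (2 * of_real pi * \<i> * Complex x y)" .
      show ?thesis unfolding g_def e[symmetric] by simp
    qed
    ultimately show ?thesis using QL[of "Complex x y"] by (auto simp: L_def)
  qed
  define F where "F = (\<lambda>\<zeta>. Ln (\<zeta> ^ s * (\<kappa> * Q (g \<zeta>))) - of_nat s * Ln \<zeta>)"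
  have dg: "(g has_field_derivative 2 * of_real pi * \<i> * g \<zeta>) (at \<zeta>)" for \<zeta>
    unfolding g_def by (auto intro!: derivative_eq_intros)
  have dF: "(F has_field_derivative deriv g \<zeta> * (deriv Q (g \<zeta>) / Q (g \<zeta>))) (at \<zeta>)" if \<zeta>: "\<zeta> \<in> L" for \<zeta>
  proof -
    have \<zeta>0: "\<zeta> \<noteq> 0" "\<zeta> \<notin> \<real>\<^sub>\<le>\<^sub>0"
      using \<zeta> y by (auto simp: L_def complex_nonpos_Reals_iff complex_eq_iff)
    have K: "\<zeta> ^ s * (\<kappa> * Q (g \<zeta>)) \<notin> \<real>\<^sub>\<le>\<^sub>0"
      using pos[OF \<zeta>] by (auto simp: complex_nonpos_Reals_iff)
    have \<kappa>0: "\<kappa> \<noteq> 0" by (simp add: \<kappa>_def)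
    have "(Q has_field_derivative deriv Q (g \<zeta>)) (at (g \<zeta>))"
      using holQ gL[OF \<zeta>] by (intro holomorphic_derivI[of _ "ball 0 1"]) auto
    from DERIV_chain2[OF this dg]
    have dQ: "((\<lambda>\<zeta>. Q (g \<zeta>)) has_field_derivative deriv Q (g \<zeta>) * (2 * of_real pi * \<i> * g \<zeta>)) (at \<zeta>)" .
    have "(F has_field_derivative
        inverse (\<zeta> ^ s * (\<kappa> * Q (g \<zeta>))) *
          (of_nat s * \<zeta> ^ (s - 1) * (\<kappa> * Q (g \<zeta>)) + \<zeta> ^ s * (\<kappa> * (deriv Q (g \<zeta>) * (2 * of_real pi * \<i> * g \<zeta>))))
        - of_nat s * inverse \<zeta>) (at \<zeta>)"
      unfolding F_def using K \<zeta>0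
      by (auto intro!: derivative_eq_intros dQ simp: algebra_simps divide_inverse)
    moreover have "\<zeta> ^ s = \<zeta> * \<zeta> ^ (s - 1)" using s by (cases s) auto
    hence "inverse (\<zeta> ^ s * (\<kappa> * Q (g \<zeta>))) *
          (of_nat s * \<zeta> ^ (s - 1) * (\<kappa> * Q (g \<zeta>)) + \<zeta> ^ s * (\<kappa> * (deriv Q (g \<zeta>) * (2 * of_real pi * \<i> * g \<zeta>))))
        - of_nat s * inverse \<zeta> = deriv g \<zeta> * (deriv Q (g \<zeta>) / Q (g \<zeta>))"
      unfolding DERIV_imp_deriv[OF dg] using \<zeta>0 \<kappa>0 QL[OF \<zeta>] by (simp add: field_simps)
    ultimately show ?thesis by simp
  qed
  define z0 where "z0 = Complex (- 1 / 2) y"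
  define z1 where "z1 = Complex (1 / 2) y"
  have lin: "linepath z0 z1 t = Complex (t - 1 / 2) y" for t
    by (simp add: linepath_def z0_def z1_def complex_eq_iff algebra_simps)
  have img: "path_image (linepath z0 z1) \<subseteq> L"
  proof -
    have "\<bar>t - 1 / 2\<bar> \<le> 1 / 2" if "t \<in> {0..1}" for t :: real
      unfolding abs_le_iff using that by auto
    thus ?thesis unfolding path_image_def lin L_def by blast
  qed
  have "g \<circ> linepath z0 z1 = circlepath 0 R"
  proof
    fix t
    have "2 * of_real pi * \<i> * Complex (t - 1 / 2) y =
        (of_real (- 2 * pi * y) + 2 * of_real pi * \<i> * of_real t) + - (of_real pi * \<i>)"
      by (simp add: complex_eq_iff algebra_simps)
    hence "exp (2 * of_real pi * \<i> * Complex (t - 1 / 2) y) = - (of_real R * exp (2 * of_real pi * \<i> * of_real t))"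
      by (simp only: exp_add exp_minus[of "of_real pi * \<i>"] exp_pi_i exp_of_real R) simp
    thus "(g \<circ> linepath z0 z1) t = circlepath 0 R t"
      by (simp add: lin g_def circlepath)
  qed
  hence "contour_integral (circlepath 0 R) (\<lambda>w. deriv Q w / Q w) =
      contour_integral (g \<circ> linepath z0 z1) (\<lambda>w. deriv Q w / Q w)" by simp
  also have "\<dots> = contour_integral (linepath z0 z1) (\<lambda>\<zeta>. deriv g \<zeta> * (deriv Q (g \<zeta>) / Q (g \<zeta>)))"
    by (rule contour_integral_comp_analyticW[of _ UNIV]) (auto simp: g_def intro!: analytic_intros)
  also have "\<dots> = F z1 - F z0"
    using contour_integral_primitive[OF has_field_derivative_at_within[OF dF], of L "linepath z0 z1"] img
    by (intro contour_integral_unique) simp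
  also have "\<dots> = of_nat s * (Ln z0 - Ln z1)"
  proof -
    have "g z0 = g z1"
    proof -
      have "z1 = z0 + 1" by (simp add: z0_def z1_def complex_eq_iff)
      thus ?thesis by (simp add: g_def distrib_left exp_add)
    qed
    moreover have "z0 ^ s = z1 ^ s"
    proof -
      have "(z0 / z1) ^ s = 1"
        using edge_phase(1)[of j s] j' by (simp add: z0_def z1_def y_def \<alpha>_def)
      moreover have "z1 \<noteq> 0" by (simp add: z1_def complex_eq_iff)
      ultimately show ?thesis by (simp add: power_divide)
    qed
    ultimately show ?thesis by (simp add: F_def algebra_simps)
  qed
  also have "\<dots> = of_nat s * (2 * \<i> * of_real \<alpha>)"
    using Ln_edge_points[OF \<alpha>] by (simp add: z0_def z1_def y_def)
  also have "\<dots> = 2 * of_real pi * \<i> * of_nat j"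
    using s by (simp add: \<alpha>_def)
  finally show "contour_integral (circlepath 0 R) (\<lambda>w. deriv Q w / Q w) = 2 * of_real pi * \<i> * of_nat j" .
qed

lemma sum_zorder_eis:
  assumes k: "even k" "k \<ge> 8" and j: "0 < j" "Suc k \<le> 6 * j" "13 * j \<le> 3 * Suc k"
  defines "Q \<equiv> \<lambda>w. eis_deriv_series k (- w)"
    and "R \<equiv> exp (- 2 * pi * (1 / (2 * tan (real j * pi / real (Suc k)))))"
  shows "finite {w. norm w < R \<and> Q w = 0}"
    and "(\<Sum>w | norm w < R \<and> Q w = 0. zorder Q w) = int j"
    and "\<And>w. norm w < R \<Longrightarrow> Q w = 0 \<Longrightarrow> zorder Q w \<ge> 1"
proof -
  have cint: "contour_integral (circlepath 0 R) (\<lambda>w. deriv Q w / Q w) = 2 * of_real pi * \<i> * of_nat j"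
    unfolding Q_def R_def by (rule contour_integral_log_deriv_eis(1)[OF k j])
  have Qnz: "Q w \<noteq> 0" if "norm w = R" for w
    using contour_integral_log_deriv_eis(2)[OF k j] that unfolding Q_def R_def by blast
  define y where "y = 1 / (2 * tan (real j * pi / real (Suc k)))"
  have R: "R = exp (- 2 * pi * y)" by (simp add: R_def y_def)
  have "y > 0" using tan_edge_bounds(1)[OF j, folded y_def] by simp
  hence R1: "R < 1" "R > 0" by (auto simp: R)
  have holQ: "Q holomorphic_on ball 0 1"
    unfolding Q_def
    by (rule holomorphic_on_compose_gen[of uminus, unfolded o_def, OF _ holomorphic_eis_deriv_series])
      (use k in \<open>auto intro!: holomorphic_intros\<close>)
  \<comment> \<open>The argument principle needs an open set around the circle with finitely many
    zeros; those outside the circle have winding number 0.\<close>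
  define R' where "R' = (R + 1) / 2"
  have R': "R < R'" "R' < 1" "0 < R'" using R1 by (auto simp: R'_def)
  have QR: "Q (of_real R) \<noteq> 0" using Qnz R1 by simp
  have Q0: "Q 0 = 0"
    by (simp add: Q_def eis_deriv_series_0)
  have "\<not> Q constant_on ball 0 1"
  proof
    assume "Q constant_on ball 0 1"
    hence "Q (of_real R) = Q 0" using R1 unfolding constant_on_def by auto
    thus False using QR Q0 by simp
  qed
  hence fin: "finite {w \<in> cball 0 R'. Q w = 0}"
    using R' by (intro holomorphic_compact_finite_zeros[OF holQ]) (auto simp: cball_subset_ball_iff)
  define pz where "pz = {w \<in> ball 0 R'. Q w = 0 \<or> w \<in> {}}"
  define Z where "Z = {w. norm w < R \<and> Q w = 0}"
  have finpz: "finite pz" by (rule finite_subset[OF _ fin]) (auto simp: pz_def)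
  have Zpz: "Z \<subseteq> pz" using R' by (auto simp: Z_def pz_def)
  thus fin': "finite {w. norm w < R \<and> Q w = 0}" using finpz finite_subset unfolding Z_def by blast
  have "contour_integral (circlepath 0 R) (\<lambda>x. deriv Q x * 1 / Q x) =
      of_real (2 * pi) * \<i> * (\<Sum>p\<in>pz. winding_number (circlepath 0 R) p * 1 * of_int (zorder Q p))"
    unfolding pz_def
  proof (rule argument_principle[where h = "\<lambda>_. 1"])
    show "Q holomorphic_on ball 0 R' - {}"
      by (rule holomorphic_on_subset[OF holQ]) (use R' in auto)
    show "path_image (circlepath 0 R) \<subseteq> ball 0 R' - {w \<in> ball 0 R'. Q w = 0 \<or> w \<in> {}}"
      using R' R1 Qnz by auto
    show "\<forall>z. z \<notin> ball 0 R' \<longrightarrow> winding_number (circlepath 0 R) z = 0"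
    proof (intro allI impI)
      fix z :: complex assume "z \<notin> ball 0 R'"
      thus "winding_number (circlepath 0 R) z = 0"
        using R' R1 by (intro winding_number_zero_outside[of _ "cball 0 R"]) auto
    qed
    show "finite {w \<in> ball 0 R'. Q w = 0 \<or> w \<in> {}}" using finpz by (simp add: pz_def)
  qed auto
  also have "(\<Sum>p\<in>pz. winding_number (circlepath 0 R) p * 1 * of_int (zorder Q p)) =
      (\<Sum>p\<in>Z. winding_number (circlepath 0 R) p * 1 * of_int (zorder Q p))"
  proof (intro sum.mono_neutral_right finpz Zpz ballI)
    fix p assume p: "p \<in> pz - Z"
    hence "norm p \<noteq> R" "\<not> norm p < R" using Qnz by (auto simp: pz_def Z_def)
    hence "winding_number (circlepath 0 R) p = 0"
      using R1 by (intro winding_number_zero_outside[of _ "cball 0 R"]) auto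
    thus "winding_number (circlepath 0 R) p * 1 * of_int (zorder Q p) = 0" by simp
  qed
  also have "\<dots> = (\<Sum>p\<in>Z. of_int (zorder Q p))"
    by (intro sum.cong refl) (auto simp: Z_def winding_number_circlepath)
  finally have "2 * of_real pi * \<i> * of_nat j = 2 * of_real pi * \<i> * (\<Sum>p\<in>Z. of_int (zorder Q p))"
    using cint by simp
  hence "(of_int (int j) :: complex) = of_int (\<Sum>p\<in>Z. zorder Q p)" by simp
  thus "(\<Sum>w | norm w < R \<and> Q w = 0. zorder Q w) = int j"
    unfolding of_int_eq_iff Z_def by simp
  show "zorder Q w \<ge> 1" if "norm w < R" "Q w = 0" for w
  proof -
    have "\<exists>w\<in>ball 0 1. Q w \<noteq> 0" using QR R1 by (intro bexI[of _ "of_real R"]) auto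
    from zorder_exist_zero[OF holQ _ _ _ this, of w] show ?thesis
      using that R1 by auto
  qed
qed

section \<open>Location and simplicity of the zeros\<close>

lemma continuous_on_eis_deriv_real:
  assumes "k \<ge> 4" "0 < a" "b < 1"
  shows "continuous_on {a..b} (eis_deriv_real k)"
proof -
  have "continuous_on {a..b} (\<lambda>x. Re (eis_deriv_series k (- of_real x)))"
    by (intro continuous_intros continuous_on_compose2[OF holomorphic_on_imp_continuous_on[OF holomorphic_eis_deriv_series]])
      (use assms in auto)
  moreover have "Re (eis_deriv_series k (- of_real x)) = eis_deriv_real k x" if "x \<in> {a..b}" for x
    using assms that by (subst eis_deriv_series_of_real) auto
  ultimately show ?thesis
    by (subst continuous_on_cong[OF refl, symmetric]) auto
qed

text \<open>This is \<open>tan \<alpha> > \<alpha>\<close>; the doubling formula makes the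
  inequality at \<open>\<alpha> / 2\<close> strict.\<close>

lemma tan_edge_lt:
  assumes "0 < j" "2 * j < s"
  shows "1 / (2 * tan (real j * pi / real s)) < real s / (2 * pi * real j)"
proof -
  define \<alpha> where "\<alpha> = real j * pi / real s"
  note \<alpha> = edge_angle_bounds[OF assms, folded \<alpha>_def]
  have "tan \<alpha> > \<alpha>"
  proof -
    have "tan (\<alpha> / 2) > 0" using \<alpha> by (intro tan_gt_zero) auto
    have "\<bar>\<alpha> / 2\<bar> \<le> \<bar>tan (\<alpha> / 2)\<bar>" using \<alpha> by (intro abs_tan_ge) auto
    hence a: "\<alpha> / 2 \<le> tan (\<alpha> / 2)" using \<alpha> \<open>tan (\<alpha> / 2) > 0\<close> by simp
    have "tan (\<alpha> / 2) < tan (pi / 4)" using \<alpha> by (intro tan_monotone) auto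
    hence t1: "tan (\<alpha> / 2) < 1" by (simp add: tan_45)
    have "cos (\<alpha> / 2) \<noteq> 0" "cos (2 * (\<alpha> / 2)) \<noteq> 0"
      using \<alpha> by (intro order.strict_implies_not_eq[symmetric] cos_gt_zero_pi; simp)+
    from tan_double[OF this] have "tan \<alpha> = 2 * tan (\<alpha> / 2) / (1 - (tan (\<alpha> / 2))\<^sup>2)" by simp
    moreover have "2 * tan (\<alpha> / 2) < 2 * tan (\<alpha> / 2) / (1 - (tan (\<alpha> / 2))\<^sup>2)"
      using t1 \<open>tan (\<alpha> / 2) > 0\<close> by (simp add: less_divide_eq power_less_one_iff abs_square_less_1)
    ultimately show ?thesis using a by linarith
  qed
  hence "1 / (2 * tan \<alpha>) < 1 / (2 * \<alpha>)"
    using \<alpha> by (intro divide_strict_left_mono) auto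
  thus ?thesis by (simp add: \<alpha>_def mult_ac)
qed

text \<open>The intermediate value theorem gives \<open>J - 1\<close> positive zeros, which with 0
  are \<open>J\<close> distinct ones. As \<open>J\<close> is also the count with multiplicity, there
  are no others and each order is 1.\<close>

lemma eis_deriv_series_zeros_in_disc:
  assumes k: "even k" "k \<ge> 8" and J: "0 < J" "Suc k \<le> 6 * J" "13 * J \<le> 3 * Suc k"
  defines "Q \<equiv> \<lambda>w. eis_deriv_series k (- w)"
    and "R \<equiv> exp (- 2 * pi * (1 / (2 * tan (real J * pi / real (Suc k)))))"
  assumes w: "norm w < R" "Q w = 0"
  shows "zorder Q w = 1 \<and> (\<exists>x\<ge>0. w = of_real x)"
proof -
  define s where "s = Suc k"
  have s: "s \<ge> 9" "real s = real k + 1" using k by (auto simp: s_def)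
  define h where "h = (\<lambda>i::nat. 1 / (2 * tan (real i * pi / real s)))"
  \<comment> \<open>The first height corresponds to the peak \<open>exp (- k / i)\<close>. The last
    index always takes the edge height, so that \<open>W J = R\<close>.\<close>
  define Y where "Y = (\<lambda>i. if 4 * i\<^sup>2 \<le> k \<and> i < J then real k / (2 * pi * real i) else h i)"
  define W where "W = (\<lambda>i. exp (- 2 * pi * Y i))"
  have less: "2 * i < s" if "i \<le> J" for i using that J by (simp add: s_def)
  have hJ: "11 / 20 \<le> h J" "(h J)\<^sup>2 \<le> 3 / 4"
    using tan_edge_bounds[OF J] by (simp_all add: h_def s_def)
  have h_mono: "h i' < h i" if "0 < i" "i < i'" "i' \<le> J" for i i'
  proof -
    have b: "0 < real i * pi / real s" "real i' * pi / real s < pi / 2"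
      using edge_angle_bounds[of i' s] edge_angle_bounds[of i s] less[of i'] less[of i] that by simp_all
    have c: "real i * pi / real s < real i' * pi / real s"
      using that s by (intro divide_strict_right_mono mult_strict_right_mono) auto
    have "tan (real i * pi / real s) < tan (real i' * pi / real s)"
      using b c pi_gt_zero by (intro tan_monotone) linarith+
    moreover have "0 < tan (real i * pi / real s)"
      using b c by (intro tan_gt_zero) linarith+
    ultimately show ?thesis
      unfolding h_def by (intro divide_strict_left_mono) auto
  qed
  have h_pos: "h i > 0" if "0 < i" "i \<le> J" for i
    using hJ h_mono[of i J] that by (cases "i = J") auto
  have Y_pos: "Y i > 0" if "0 < i" "i \<le> J" for i
    using h_pos[OF that] that k by (auto simp: Y_def)
  have Y_dec: "Y (Suc i) < Y i" if i: "0 < i" "i < J" for i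
  proof (cases "4 * i\<^sup>2 \<le> k")
    case True
    have Yi: "Y i = real k / (2 * pi * real i)" using True i by (simp add: Y_def)
    have "i \<le> i\<^sup>2" by (simp add: power2_eq_square)
    hence ik: "real i \<le> real k" using True by linarith
    show ?thesis
    proof (cases "4 * (Suc i)\<^sup>2 \<le> k \<and> Suc i < J")
      case True
      hence "Y (Suc i) = real k / (2 * pi * real (Suc i))" unfolding Y_def by (rule if_P)
      also have "\<dots> < real k / (2 * pi * real i)"
        using i k by (intro divide_strict_left_mono mult_strict_left_mono mult_pos_pos) auto
      finally show ?thesis unfolding Yi .
    next
      case False
      \<comment> \<open>At the change from peak to edge heights the order persists because
        \<open>(k + 1) i \<le> k (i + 1)\<close>.\<close>
      hence "Y (Suc i) = h (Suc i)" unfolding Y_def by (rule if_not_P)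
      also have "\<dots> < real s / (2 * pi * real (Suc i))"
        unfolding h_def using i less[of "Suc i"] by (intro tan_edge_lt) auto
      also have "\<dots> \<le> real k / (2 * pi * real i)"
      proof -
        have "real s * real i \<le> real k * real (Suc i)"
          using ik s by (simp add: algebra_simps)
        hence "real s / real (Suc i) \<le> real k / real i"
          using i by (simp only: divide_le_eq pos_le_divide_eq times_divide_eq_left of_nat_0_less_iff zero_less_Suc if_True)
        from divide_right_mono[OF this, of "2 * pi"] show ?thesis
          by (simp only: divide_divide_eq_left mult_ac) simp
      qed
      finally show ?thesis unfolding Yi .
    qed
  next
    case False
    moreover have "\<not> 4 * (Suc i)\<^sup>2 \<le> k"
      using False power_mono[of i "Suc i" 2] by linarith
    ultimately show ?thesis
      using h_mono[of i "Suc i"] i by (simp add: Y_def)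
  qed
  have W_inc: "W i < W (Suc i)" if "0 < i" "i < J" for i
    using Y_dec[OF that] by (simp add: W_def)
  have W_mono: "W i \<le> W i'" if "0 < i" "i \<le> i'" "i' \<le> J" for i i'
    using that(2,3)
  proof (induction i' rule: dec_induct)
    case (step n)
    thus ?case using W_inc[of n] that(1) by simp
  qed simp
  have W01: "0 < W i" "W i < 1" if "0 < i" "i \<le> J" for i
    using Y_pos[OF that] by (auto simp: W_def)
  have WJ: "W J = R" by (simp add: W_def Y_def h_def R_def s_def)
  have sign: "(-1) ^ i * eis_deriv_real k (W i) > 0" if i: "0 < i" "i \<le> J" for i
  proof (cases "4 * i\<^sup>2 \<le> k \<and> i < J")
    case True
    hence "W i = exp (- (real k / real i))" using i by (simp add: W_def Y_def)
    thus ?thesis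
      using eis_deriv_real_sign_peak[of k i] True i k by simp
  next
    case False
    \<comment> \<open>For \<open>i < J\<close> the failed peak condition \<open>4 i^2 > k\<close>
      bounds \<open>(h i)^2\<close> by \<open>s^2 / (9 k)\<close>, and \<open>8 s \<le> 9 k\<close>
      is exactly \<open>k \<ge> 8\<close>.\<close>
    have "(h i)\<^sup>2 \<le> real s / 8"
    proof (cases "i = J")
      case True
      thus ?thesis using hJ(2) s by simp
    next
      case ne: False
      hence "real k \<le> real (4 * i\<^sup>2)" using False i by (simp only: of_nat_le_iff) linarith
      hence ki: "real k \<le> 4 * (real i)\<^sup>2" by simp
      have "h i \<le> real s / (2 * pi * real i)"
        unfolding h_def by (intro less_imp_le tan_edge_lt less i)
      hence "(h i)\<^sup>2 \<le> (real s / (2 * pi * real i))\<^sup>2"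
        using h_pos[OF i] by (intro power_mono) auto
      also have "\<dots> = (real s)\<^sup>2 / (pi\<^sup>2 * (4 * (real i)\<^sup>2))"
        by (simp add: power_divide power_mult_distrib)
      also have "\<dots> \<le> (real s)\<^sup>2 / (9 * real k)"
      proof (intro divide_left_mono mult_mono mult_pos_pos)
        have "3\<^sup>2 \<le> pi\<^sup>2" using pi_gt3 by (intro power_mono) auto
        thus "9 \<le> pi\<^sup>2" by simp
      qed (use k i ki in auto)
      also have "\<dots> \<le> real s / 8"
      proof -
        have "real s * (8 * real s) \<le> real s * (9 * real k)"
          using k s by (intro mult_left_mono) auto
        thus ?thesis using k by (simp add: divide_le_eq power2_eq_square mult_ac)
      qed
      finally show ?thesis .
    qed
    moreover have "11 / 20 \<le> h i"
      using hJ(1) h_mono[of i J] i by (cases "i = J") auto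
    ultimately have "(-1) ^ i * eis_deriv_real k (exp (- 2 * pi * h i)) > 0"
      using less[OF i(2)] unfolding h_def s_def by (intro eis_deriv_real_sign_edge[OF k i(1)])
    moreover have "W i = exp (- 2 * pi * h i)"
      using False by (auto simp: W_def Y_def)
    ultimately show ?thesis by (simp only:)
  qed
  have "\<exists>x. W i \<le> x \<and> x \<le> W (Suc i) \<and> eis_deriv_real k x = 0" if i: "i \<in> {1..<J}" for i
  proof -
    have "continuous_on {W i..W (Suc i)} (\<lambda>x. (-1) ^ i * eis_deriv_real k x)"
      using W01[of i] W01[of "Suc i"] i k by (intro continuous_intros continuous_on_eis_deriv_real) auto
    moreover have "(-1) ^ i * eis_deriv_real k (W (Suc i)) \<le> 0"
      using sign[of "Suc i"] i by simp
    moreover have "0 \<le> (-1) ^ i * eis_deriv_real k (W i)"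
      using sign[of i] i by simp
    ultimately show ?thesis
      using IVT2'[of "\<lambda>x. (-1) ^ i * eis_deriv_real k x" "W (Suc i)" 0 "W i"] W_inc[of i] i by auto
  qed
  then obtain X where X: "\<And>i. i \<in> {1..<J} \<Longrightarrow> W i \<le> X i \<and> X i \<le> W (Suc i) \<and> eis_deriv_real k (X i) = 0"
    by metis
  have nz: "eis_deriv_real k (W i) \<noteq> 0" if "0 < i" "i \<le> J" for i
    using sign[OF that] by (metis mult_zero_right order_less_irrefl)
  have X': "W i < X i" "X i < W (Suc i)" if "i \<in> {1..<J}" for i
  proof -
    have "X i \<noteq> W i" "X i \<noteq> W (Suc i)"
      using X[OF that] nz[of i] nz[of "Suc i"] that by force+
    thus "W i < X i" "X i < W (Suc i)" using X[OF that] by linarith+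
  qed
  have X_inc: "X i < X i'" if "i \<in> {1..<J}" "i' \<in> {1..<J}" "i < i'" for i i'
    using X'(2)[OF that(1)] X'(1)[OF that(2)] W_mono[of "Suc i" i'] that by auto
  have inj: "inj_on X {1..<J}"
    by (rule linorder_inj_onI) (use X_inc in force)+
  have X_pos: "0 < X i" "X i < R" if "i \<in> {1..<J}" for i
    using X'[OF that] W01[of i] W_mono[of "Suc i" J] that WJ by auto
  have R1: "R < 1" using W01[of J] WJ J by simp

  define A where "A = {w. norm w < R \<and> Q w = 0}"
  define Z where "Z = (of_real ` (insert 0 (X ` {1..<J})) :: complex set)"
  have "card Z = card (insert 0 (X ` {1..<J}))"
    unfolding Z_def by (intro card_image inj_onI) auto
  also have "\<dots> = Suc (card (X ` {1..<J}))"
    using X_pos(1) by (subst card_insert_disjoint) force+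
  also have "\<dots> = J"
    using card_image[OF inj] J by simp
  finally have cZ: "card Z = J" .
  have ZA: "Z \<subseteq> A"
  proof
    fix z assume "z \<in> Z"
    then consider "z = 0" | i where "i \<in> {1..<J}" "z = of_real (X i)"
      by (auto simp: Z_def)
    thus "z \<in> A"
    proof cases
      case 1
      thus ?thesis by (simp add: A_def Q_def eis_deriv_series_0 R_def)
    next
      case 2
      thus ?thesis
        using X_pos[of i] R1 X[of i] k by (auto simp: A_def Q_def eis_deriv_series_of_real)
    qed
  qed
  have finA: "finite A" and sumA: "(\<Sum>w\<in>A. zorder Q w) = int J" and z1: "\<And>w. w \<in> A \<Longrightarrow> zorder Q w \<ge> 1"
    using sum_zorder_eis[OF k J] unfolding A_def Q_def R_def by blast+
  have "int (card A) \<le> int J"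
    using sum_mono[of A "\<lambda>_. 1" "zorder Q"] z1 sumA by simp
  hence AZ: "A = Z" using card_seteq[OF finA ZA] cZ by simp
  have "(\<Sum>w\<in>A. zorder Q w - 1) = 0"
    using sumA cZ AZ by (simp add: sum_subtractf)
  moreover have "0 \<le> zorder Q w - 1" if "w \<in> A" for w
    using z1[OF that] by simp
  ultimately have "\<forall>w\<in>A. zorder Q w - 1 = 0"
    using finA by (subst (asm) sum_nonneg_eq_0_iff) simp_all
  moreover have "w \<in> A" using w by (simp add: A_def)
  moreover have "\<exists>x\<ge>0. w = of_real x"
  proof -
    from \<open>w \<in> A\<close> consider "w = of_real 0" | i where "i \<in> {1..<J}" "w = of_real (X i)"
      unfolding AZ Z_def by auto
    thus ?thesis
      using X_pos(1) less_imp_le by cases blast+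
  qed
  ultimately show ?thesis by simp
qed

lemma deriv_neq_0_if_zorder_eq_1:
  assumes "f holomorphic_on S" "open S" "connected S" "z \<in> S" "f z = 0" "zorder f z = 1" "\<exists>w\<in>S. f w \<noteq> 0"
  shows "deriv f z \<noteq> 0"
proof -
  obtain r where r: "r > 0" "zor_poly f z holomorphic_on cball z r"
    "\<And>w. w \<in> cball z r \<Longrightarrow> f w = zor_poly f z w * (w - z) ^ 1 \<and> zor_poly f z w \<noteq> 0"
    using zorder_exist_zero[OF assms(1-4,7)] assms(6) by auto
  have "zor_poly f z field_differentiable at z"
    using r by (meson holomorphic_on_imp_differentiable_at holomorphic_on_subset ball_subset_cball open_ball centre_in_ball)
  then obtain D where D: "(zor_poly f z has_field_derivative D) (at z)"
    by (auto simp: field_differentiable_def)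
  have "((\<lambda>w. zor_poly f z w * (w - z)) has_field_derivative zor_poly f z z) (at z)"
    by (auto intro!: derivative_eq_intros D)
  hence "(f has_field_derivative zor_poly f z z) (at z)"
    by (rule has_field_derivative_transform_within_open[of _ _ _ "ball z r"]) (use r in auto)
  thus ?thesis
    using DERIV_imp_deriv r(1) r(3)[of z] by fastforce
qed

text \<open>From \<open>n \<le> 2 ^ (n - 1)\<close> the coefficients are at most
  \<open>5/4 * 64 ^ (n - 1)\<close>. The tail is smaller than \<open>norm q\<close> as soon as
  \<open>64 x * 9/4 < 1\<close>, that is \<open>x < 1 / 144\<close>.\<close>

lemma eis_deriv_series_nonzero_small_weight:
  assumes "k = 4 \<or> k = 6" "q \<noteq> 0" "norm q < 1 / 144"
  shows "eis_deriv_series k q \<noteq> 0"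
proof -
  define a where "a = (\<lambda>n. of_nat (n * divisor_sigma (k - 1) n) :: complex)"
  define x where "x = norm q"
  have x: "0 < x" "x < 1 / 144" using assms by (auto simp: x_def)
  have k: "k \<ge> 4" "k \<le> 6" using assms by auto
  have sm: "summable (\<lambda>n. a n * q ^ n)"
    using summable_eis_deriv_series[OF k(1), of q] x unfolding a_def x_def by (intro summable_norm_cancel[of "\<lambda>n. _ n * q ^ n"]) auto
  have bound: "norm (a (n + 2) * q ^ (n + 2)) \<le> (5 / 4 * x * (64 * x)) * (64 * x) ^ n" for n
  proof -
    have "n + 2 \<le> 2 ^ (n + 1)" by (induction n) auto
    hence n2: "real (n + 2) \<le> 2 ^ (n + 1)"
      by (metis of_nat_le_iff of_nat_numeral of_nat_power)
    have "real (n + 2) ^ k \<le> real (n + 2) ^ 6"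
      using k by (intro power_increasing) auto
    also have "\<dots> \<le> (2 ^ (n + 1)) ^ 6"
      using n2 by (intro power_mono) auto
    also have "\<dots> = 64 ^ (n + 1)"
    proof -
      have "((2 :: real) ^ (n + 1)) ^ 6 = (2 ^ 6) ^ (n + 1)"
        by (simp only: power_mult[symmetric] mult.commute)
      thus ?thesis by simp
    qed
    finally have "real ((n + 2) * divisor_sigma (k - 1) (n + 2)) \<le> 5 / 4 * 64 ^ (n + 1)"
      using nat_times_divisor_sigma_le[OF k(1), of "n + 2"] by linarith
    hence "real ((n + 2) * divisor_sigma (k - 1) (n + 2)) * x ^ (n + 2) \<le> 5 / 4 * 64 ^ (n + 1) * x ^ (n + 2)"
      using x by (intro mult_right_mono) auto
    moreover have "norm (a (n + 2) * q ^ (n + 2)) = real ((n + 2) * divisor_sigma (k - 1) (n + 2)) * x ^ (n + 2)"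
      unfolding a_def norm_mult norm_power x_def norm_of_nat ..
    moreover have "5 / 4 * 64 ^ (n + 1) * x ^ (n + 2) = (5 / 4 * x * (64 * x)) * (64 * x) ^ n"
      by (simp add: power_mult_distrib)
    ultimately show ?thesis by (simp only:)
  qed
  have gs: "(\<lambda>n. (5 / 4 * x * (64 * x)) * (64 * x) ^ n) sums ((5 / 4 * x * (64 * x)) * (1 / (1 - 64 * x)))"
    using x by (intro sums_mult geometric_sums) auto
  have "norm (\<Sum>n. a (n + 2) * q ^ (n + 2)) \<le> (5 / 4 * x * (64 * x)) * (1 / (1 - 64 * x))"
    using norm_suminf_le[OF bound sums_summable[OF gs]] unfolding sums_unique[OF gs, symmetric] .
  also have "\<dots> < x"
  proof -
    have "5 / 4 * (64 * x) < 1 - 64 * x" using x by simp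
    hence "x * (5 / 4 * (64 * x)) < x * (1 - 64 * x)"
      using x by (intro mult_strict_left_mono) auto
    thus ?thesis using x by (simp add: divide_less_eq mult_ac)
  qed
  finally have "norm (\<Sum>n. a (n + 2) * q ^ (n + 2)) < norm q" by (simp add: x_def)
  moreover have "eis_deriv_series k q = (\<Sum>n. a (n + 2) * q ^ (n + 2)) + q"
  proof -
    have "a 1 = 1" by (simp add: a_def divisor_sigma_def)
    hence "(\<Sum>n<2. a n * q ^ n) = q"
      by (simp add: numeral_2_eq_2 a_def)
    thus ?thesis
      using suminf_split_initial_segment[OF sm, of 2] by (simp add: eis_deriv_series_def a_def)
  qed
  ultimately show ?thesis
    by (metis add_eq_0_iff norm_minus_cancel order_less_irrefl)
qed

lemma eis_deriv_series_zeros: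
  assumes k: "even k" "k \<ge> 4" and z: "(Im z)\<^sup>2 \<ge> 3 / 4" "Im z > 0"
    and zero: "eis_deriv_series k (exp (2 * of_real pi * \<i> * z)) = 0"
  shows "\<exists>x>0. exp (2 * of_real pi * \<i> * z) = - of_real x"
    and "deriv (eis_deriv_series k) (exp (2 * of_real pi * \<i> * z)) \<noteq> 0"
proof -
  define q where "q = exp (2 * of_real pi * \<i> * z)"
  have nq: "norm q = exp (- 2 * pi * Im z)"
    unfolding q_def by (rule norm_exp_2pi_i)
  have q1: "norm q < 1" "q \<noteq> 0" using z(2) by (auto simp: nq) (simp add: q_def)
  have y: "Im z \<ge> 0.86"
  proof (rule power2_le_imp_le)
    show "0.86\<^sup>2 \<le> (Im z)\<^sup>2" using z(1) by (simp add: power2_eq_square)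
  qed (use z in auto)
  have k8: "k \<ge> 8"
  proof (rule ccontr)
    assume "\<not> k \<ge> 8"
    hence k46: "k = 4 \<or> k = 6" using k by presburger
    have "3.14 * 0.86 \<le> pi * Im z"
      using y pi_approx by (intro mult_mono) auto
    hence "norm q \<le> exp (- 5)" by (simp add: nq)
    also have "exp (- 5) < 1 / (144 :: real)"
    proof -
      have "- inverse (2 ^ 32) \<le> exp 1 - 5837465777 / (2147483648 :: real)"
        using e_approx_32 unfolding abs_le_iff by linarith
      hence "2.718 ^ 5 \<le> exp (1 :: real) ^ 5" by (intro power_mono) simp_all
      also have "exp (1 :: real) ^ 5 = exp 5" by (simp flip: exp_of_nat_mult)
      finally have "144 < exp (5 :: real)" by (simp add: power_def eval_nat_numeral)
      thus ?thesis by (simp add: exp_minus field_simps)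
    qed
    finally have "eis_deriv_series k q \<noteq> 0"
      using k46 q1 by (intro eis_deriv_series_nonzero_small_weight)
    thus False using zero by (simp add: q_def)
  qed
  \<comment> \<open>This is \<open>(k + 1) / 6\<close> rounded up, the least \<open>j\<close> with
    angle at least \<open>\<pi> / 6\<close>.\<close>
  define J where "J = (k + 6) div 6"
  have J: "0 < J" "Suc k \<le> 6 * J" "13 * J \<le> 3 * Suc k"
  proof -
    have J6: "6 * J \<le> k + 6" "k + 6 < 6 + 6 * J"
      using div_times_less_eq_dividend[of "k + 6" 6] dividend_less_div_times[of 6 "k + 6"]
      by (simp_all add: J_def mult.commute)
    thus "0 < J" "Suc k \<le> 6 * J" by linarith+
    \<comment> \<open>From \<open>k \<ge> 12\<close> on, \<open>6 J \<le> k + 6\<close> suffices;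
      for 8 and 10 the value \<open>J = 2\<close> is checked directly.\<close>
    have "k = 8 \<or> k = 10 \<or> k \<ge> 12" using k(1) k8 by presburger
    thus "13 * J \<le> 3 * Suc k" using J6 by (auto simp: J_def)
  qed
  define h where "h = 1 / (2 * tan (real J * pi / real (Suc k)))"
  define R where "R = exp (- 2 * pi * h)"
  define Q where "Q = (\<lambda>w. eis_deriv_series k (- w))"
  have "h\<^sup>2 \<le> (Im z)\<^sup>2" using tan_edge_bounds(2)[OF J] z by (simp add: h_def)
  hence "h \<le> Im z" using z by (intro power2_le_imp_le[of h]) auto
  hence "norm (- q) \<le> R" by (simp add: nq R_def)
  \<comment> \<open>The height condition only gives the closed disc; its boundary carries no
    zeros.\<close>
  moreover have "norm (- q) \<noteq> R"
    using contour_integral_log_deriv_eis(2)[OF k(1) k8 J, of "- q"] zero unfolding R_def h_def q_def by auto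
  ultimately have "norm (- q) < R" by simp
  moreover have Q0: "Q (- q) = 0" using zero by (simp add: Q_def q_def)
  ultimately have *: "zorder Q (- q) = 1" "\<exists>x\<ge>0. - q = of_real x"
    using eis_deriv_series_zeros_in_disc[OF k(1) k8 J, of "- q"] unfolding Q_def R_def h_def by auto
  show "\<exists>x>0. exp (2 * of_real pi * \<i> * z) = - of_real x"
  proof -
    from *(2) obtain x where x: "x \<ge> 0" "- q = of_real x" by auto
    have "x \<noteq> 0" using x(2) q1(2) by auto
    moreover have "q = - of_real x" using x(2) by (metis minus_minus)
    ultimately show ?thesis using x(1) unfolding q_def by (intro exI[of _ x]) auto
  qed
  have hol: "eis_deriv_series k holomorphic_on ball 0 1"
    using k by (intro holomorphic_eis_deriv_series)
  have holQ: "Q holomorphic_on ball 0 1"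
    unfolding Q_def
    by (rule holomorphic_on_compose_gen[of uminus, unfolded o_def, OF _ hol]) (auto intro!: holomorphic_intros)
  have R1: "0 < R" "R < 1"
    using tan_edge_bounds(1)[OF J] pi_gt_zero unfolding R_def h_def[symmetric] by (auto simp: mult_pos_pos)
  have "Q (of_real R) \<noteq> 0"
    using contour_integral_log_deriv_eis(2)[OF k(1) k8 J, of "of_real R"] R1 unfolding Q_def R_def h_def by simp
  hence "\<exists>w\<in>ball 0 1. Q w \<noteq> 0"
    using R1 by (intro bexI[of _ "of_real R"]) auto
  hence "deriv Q (- q) \<noteq> 0"
    using q1 Q0 *(1) by (intro deriv_neq_0_if_zorder_eq_1[OF holQ]) auto
  moreover have "deriv Q (- q) = - deriv (eis_deriv_series k) q"
  proof (rule DERIV_imp_deriv)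
    have "(eis_deriv_series k has_field_derivative deriv (eis_deriv_series k) q) (at (- (- q)))"
      using q1 by (simp add: holomorphic_derivI[OF hol])
    from DERIV_chain2[OF this DERIV_minus[OF DERIV_ident]]
    show "(Q has_field_derivative - deriv (eis_deriv_series k) q) (at (- q))"
      unfolding Q_def by simp
  qed
  ultimately show "deriv (eis_deriv_series k) (exp (2 * of_real pi * \<i> * z)) \<noteq> 0"
    by (simp add: q_def)
qed

lemma deriv_eisenstein_E_zeros:
  assumes k: "even k" "k \<ge> 4" and z: "(Im z)\<^sup>2 \<ge> 3 / 4" "Im z > 0" and zero: "deriv (eisenstein_E k) z = 0"
  shows "zorder (deriv (eisenstein_E k)) z = 1" and "\<exists>x>0. exp (2 * of_real pi * \<i> * z) = - of_real x"
proof -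
  define C where "C = - of_real (2 * real k / bernoulli k) * (2 * of_real pi * \<i>)"
  define E where "E = (\<lambda>z. exp (2 * of_real pi * \<i> * z))"
  define H where "H = {z. Im z > 0}"
  \<comment> \<open>Otherwise \<open>C\<close> would be 0 and the derivative would vanish
    identically.\<close>
  have "bernoulli k \<noteq> 0"
    using bernoulli_even_sign[of "k div 2"] k by auto
  hence C: "C \<noteq> 0" using k by (simp add: C_def)
  have eq: "deriv (eisenstein_E k) w = C * eis_deriv_series k (E w)" if "w \<in> H" for w
    using deriv_eisenstein_E[of k w] that k by (simp add: C_def E_def H_def)
  have zH: "z \<in> H" using z by (simp add: H_def)
  have zero': "eis_deriv_series k (E z) = 0"
    using zero C eq[OF zH] by simp
  note * = eis_deriv_series_zeros[OF k z zero'[unfolded E_def], folded E_def]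
  show "\<exists>x>0. exp (2 * of_real pi * \<i> * z) = - of_real x"
    using *(1) by (simp add: E_def)
  have openH: "open H" unfolding H_def by (rule open_halfspace_Im_gt)
  have E1: "E w \<in> ball 0 1" if "w \<in> H" for w
    using that by (simp add: E_def H_def)
  have holE: "(\<lambda>w. C * eis_deriv_series k (E w)) holomorphic_on H"
    by (intro holomorphic_intros holomorphic_on_compose_gen[unfolded o_def, OF _ holomorphic_eis_deriv_series[OF k(2)]])
      (use E1 in \<open>auto simp: E_def intro!: holomorphic_intros\<close>)
  have hol: "deriv (eisenstein_E k) holomorphic_on H"
    using holE by (rule holomorphic_transform) (simp add: eq)
  have "(eis_deriv_series k has_field_derivative deriv (eis_deriv_series k) (E z)) (at (E z))"
    using E1[OF zH] by (intro holomorphic_derivI[OF holomorphic_eis_deriv_series[OF k(2)]]) auto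
  moreover have "(E has_field_derivative 2 * of_real pi * \<i> * E z) (at z)"
    unfolding E_def by (auto intro!: derivative_eq_intros)
  ultimately have "((\<lambda>w. C * eis_deriv_series k (E w)) has_field_derivative
      C * (deriv (eis_deriv_series k) (E z) * (2 * of_real pi * \<i> * E z))) (at z)"
    by (intro DERIV_cmult) (rule DERIV_chain2)
  hence "(deriv (eisenstein_E k) has_field_derivative
      C * (deriv (eis_deriv_series k) (E z) * (2 * of_real pi * \<i> * E z))) (at z)"
    by (rule has_field_derivative_transform_within_open[OF _ openH zH]) (simp add: eq)
  from DERIV_imp_deriv[OF this] have "deriv (deriv (eisenstein_E k)) z \<noteq> 0"
    using C *(2) by (simp add: E_def)
  thus "zorder (deriv (eisenstein_E k)) z = 1"
    using zero by (intro zorder_zero_eqI[OF hol openH zH]) auto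
qed

theorem theorem1:
  fixes k :: nat
  assumes "k \<ge> 4" and "even k"
  shows "(\<forall>z\<in>fundamental_region. deriv (eisenstein_E k) z = 0 \<longrightarrow>
            zorder (deriv (eisenstein_E k)) z = 1 \<and> (Re z = 1 / 2 \<or> Re z = - (1 / 2))) \<and>
         {z \<in> fundamental_region. deriv (eisenstein_E k) z = 0 \<and> Re z = 1 / 2} =
         (\<lambda>z. z + 1) ` {z \<in> fundamental_region. deriv (eisenstein_E k) z = 0 \<and> Re z = - (1 / 2)}"
proof (intro conjI ballI impI)
  fix z assume zD: "z \<in> fundamental_region" and zero: "deriv (eisenstein_E k) z = 0"
  have z: "Im z > 0" "\<bar>Re z\<bar> \<le> 1 / 2" "norm z \<ge> 1"
    using zD by (auto simp: fundamental_region_def upper_half_plane_def)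
  have "1\<^sup>2 \<le> (norm z)\<^sup>2" using z by (intro power_mono) auto
  moreover have "\<bar>Re z\<bar>\<^sup>2 \<le> (1 / 2)\<^sup>2" using z by (intro power_mono) auto
  ultimately have z2: "(Im z)\<^sup>2 \<ge> 3 / 4"
    unfolding cmod_power2 by (simp add: power2_eq_square)
  note * = deriv_eisenstein_E_zeros[OF assms(2,1) z2 z(1) zero]
  show "zorder (deriv (eisenstein_E k)) z = 1" by (rule *(1))
  from *(2) obtain x where x: "x > 0" "exp (2 * of_real pi * \<i> * z) = - of_real x" by auto
  \<comment> \<open>A negative real \<open>q\<close> forces \<open>cos (2 \<pi> Re z) = -1\<close>,
    so \<open>Re z\<close> is half an odd integer.\<close>
  have "exp (2 * of_real pi * \<i> * z) = of_real (exp (- 2 * pi * Im z)) * cis (2 * pi * Re z)"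
    by (simp add: exp_eq_polar)
  hence e: "of_real (exp (- 2 * pi * Im z)) * cis (2 * pi * Re z) = - of_real x" using x by simp
  from arg_cong[OF e, of norm] have "exp (- 2 * pi * Im z) = x" using x by (simp add: norm_mult)
  with arg_cong[OF e, of Re] have "x * (cos (2 * pi * Re z) + 1) = 0"
    by (simp add: distrib_left)
  hence "cos (2 * pi * Re z) = -1" using x(1) by simp
  then obtain n :: int where "2 * pi * Re z = (2 * of_int n + 1) * pi"
    by (auto simp: cos_eq_minus1)
  hence n: "2 * Re z = 2 * of_int n + 1" by (simp add: mult.commute[of _ pi] mult.assoc mult.left_commute[of _ pi])
  hence "- 1 \<le> (of_int n :: real)" "(of_int n :: real) \<le> 0"
    using z(2) unfolding abs_le_iff by linarith+
  hence "- 1 \<le> n" "n \<le> 0" by simp_all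
  hence "n = 0 \<or> n = -1" by linarith
  thus "Re z = 1 / 2 \<or> Re z = - (1 / 2)" using n by auto
next
  have per: "deriv (eisenstein_E k) (z + 1) = deriv (eisenstein_E k) z" if "Im z > 0" for z
    using deriv_eisenstein_E[of k z] deriv_eisenstein_E[of k "z + 1"] that assms
    by (simp add: distrib_left exp_add)
  have shift: "z + 1 \<in> fundamental_region \<longleftrightarrow> z \<in> fundamental_region" if "Re z = - (1 / 2)" for z
  proof -
    have "norm (z + 1) = norm z" using that by (simp add: cmod_def)
    thus ?thesis using that by (simp add: fundamental_region_def upper_half_plane_def)
  qed
  have pos: "Im z > 0" if "z \<in> fundamental_region" for z
    using that by (simp add: fundamental_region_def upper_half_plane_def)
  show "{z \<in> fundamental_region. deriv (eisenstein_E k) z = 0 \<and> Re z = 1 / 2} =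
         (\<lambda>z. z + 1) ` {z \<in> fundamental_region. deriv (eisenstein_E k) z = 0 \<and> Re z = - (1 / 2)}"
  proof (intro equalityI subsetI)
    fix z assume "z \<in> {z \<in> fundamental_region. deriv (eisenstein_E k) z = 0 \<and> Re z = 1 / 2}"
    hence "z - 1 \<in> {z \<in> fundamental_region. deriv (eisenstein_E k) z = 0 \<and> Re z = - (1 / 2)}"
      using shift[of "z - 1"] per[of "z - 1"] pos[of z] by simp
    thus "z \<in> (\<lambda>z. z + 1) ` {z \<in> fundamental_region. deriv (eisenstein_E k) z = 0 \<and> Re z = - (1 / 2)}"
      by (rule rev_image_eqI) simp
  next
    fix z assume "z \<in> (\<lambda>z. z + 1) ` {z \<in> fundamental_region. deriv (eisenstein_E k) z = 0 \<and> Re z = - (1 / 2)}"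
    thus "z \<in> {z \<in> fundamental_region. deriv (eisenstein_E k) z = 0 \<and> Re z = 1 / 2}"
      using shift per pos by auto
  qed
qed

end
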